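(* Let $(Y_1,\mathcal{Y}_1,\nu_1,S_1)$ and $(Y_2,\mathcal{Y}_2,\nu_2,S_2)$ be two ergodic invertible measure preserving systems. Let $(X,\mathcal{X},\mu)$ be the product measure space $(Y_1\times Y_2,\mathcal{Y}_1\otimes\mathcal{Y}_2,\nu_1\times\nu_2)$, and let $T_1=S_1\times\mathrm{Id}$, $T_2=\mathrm{Id}\times S_2$. Let $A\in\mathcal{X}$ with $\mu(A)>0$. Then for every $\epsilon>0$, the set $$\{n\in\mathbb{Z}\colon\ \mu(A\cap T_1^nA\cap T_2^nA)>\mu(A)^3-\epsilon\}$$ is syndetic.
   Context: The systems are probability measure preserving systems. A subset $E$ of $\mathbb{Z}$ is syndetic if there exists an integer $N>0$ such that $E\cap[M,M+N)\neq\emptyset$ for every $M\in\mathbb{Z}$. *)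

theory Defs
  imports "HOL-Probability.Probability"
begin

definition measure_preserving_system :: "'a measure \<Rightarrow> ('a \<Rightarrow> 'a) \<Rightarrow> bool" where
  "measure_preserving_system M T \<longleftrightarrow>
     prob_space M \<and> T \<in> measurable M M \<and>
     (\<forall>B\<in>sets M. measure M (T -` B \<inter> space M) = measure M B)"

(* T is only meaningful on space M, so bijectivity and the inverse are taken
   relative to space M. *)
definition invertible_mps :: "'a measure \<Rightarrow> ('a \<Rightarrow> 'a) \<Rightarrow> bool" where
  "invertible_mps M T \<longleftrightarrow>
     measure_preserving_system M T \<and>
     bij_betw T (space M) (space M) \<and>
     inv_into (space M) T \<in> measurable M M"

definition ergodic_mps :: "'a measure \<Rightarrow> ('a \<Rightarrow> 'a) \<Rightarrow> bool" where
  "ergodic_mps M T \<longleftrightarrow>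
     measure_preserving_system M T \<and>
     (\<forall>B\<in>sets M. T -` B \<inter> space M = B \<longrightarrow> measure M B = 0 \<or> measure M B = 1)"

(* The iterate T^n for an integer n, where T is a bijection of the set S. *)
definition int_iterate :: "'a set \<Rightarrow> ('a \<Rightarrow> 'a) \<Rightarrow> int \<Rightarrow> 'a \<Rightarrow> 'a" where
  "int_iterate S T n =
     (if 0 \<le> n then T ^^ nat n else (inv_into S T) ^^ nat (- n))"

definition syndetic :: "int set \<Rightarrow> bool" where
  "syndetic E \<longleftrightarrow> (\<exists>N>0. \<forall>M. E \<inter> {M..<M + N} \<noteq> {})"

end

(* Up to a small error A is a union of rectangles of a finite grid. Then
   mu(A cap T1^n A cap T2^n A) is a polynomial in the correlation matrices
   q_i(n)(k, l) = nu_i(P_k cap S_i^n P_l) of the two partitions.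

   If the set of good n is not syndetic, there are times m_0, m_1, ... all of whose
   differences m_j - m_i (i < j) are bad, and by Ramsey's theorem both correlation matrices may be
   taken nearly constant, nearly Q_1 and Q_2, along these differences. Since every Q_i is close to
   the Gram matrix of the partition at different times, it is nearly symmetric and
   nearly positive semidefinite, even after subtracting the matrix of products of the measures of
   the parts. For such Q and f = 1_A this implies that the integral of f / (Q_i f) is
   at most 1 + o(1). Integrating the AM-GM inequality
   f Q_1 f Q_2 f + d^3 f / (Q_1 f) + d^3 f / (Q_2 f) >= 3 d^2 f with d = mu(A) bounds the integral
   of f Q_1 f Q_2 f from below by d^3 - o(1), a contradiction. *)

theory Submission
  imports Defs "HOL-Library.Ramsey"
begin

section \<open>Correlation matrices along sets of differences\<close>

lemma double_sum_le_off_diagonal: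
  fixes t :: "nat \<Rightarrow> nat \<Rightarrow> real"
  assumes "\<And>i j. i < N \<Longrightarrow> j < N \<Longrightarrow> i \<noteq> j \<Longrightarrow> t i j \<le> B"
    and "\<And>i. i < N \<Longrightarrow> t i i \<le> B + C"
  shows "(\<Sum>i<N. \<Sum>j<N. t i j) \<le> real N ^ 2 * B + real N * C"
proof -
  have "(\<Sum>i<N. \<Sum>j<N. t i j) \<le> (\<Sum>i<N. \<Sum>j<N. B + (if i = j then C else 0))"
    using assms by (intro sum_mono) auto
  also have "\<dots> = real N ^ 2 * B + real N * C"
    by (simp add: sum.distrib power2_eq_square algebra_simps)
  finally show ?thesis .
qed

text \<open>Division by N^2 makes the linear term vanish as N grows. In this way diagonal terms, of
  which there are only N, drop out of double sums over times.\<close>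

lemma le_if_quadratic_growth_le:
  fixes x B C :: real
  assumes "\<And>N::nat. N > 0 \<Longrightarrow> real N ^ 2 * x \<le> real N ^ 2 * B + real N * C"
  shows "x \<le> B"
proof (rule ccontr)
  assume "\<not> x \<le> B"
  then obtain N :: nat where N: "real N * (x - B) > \<bar>C\<bar> + 1"
    using reals_Archimedean3[of "x - B"] by auto
  then have "N > 0" by (cases N) auto
  with assms[of N] have "real N * (real N * (x - B)) \<le> real N * C"
    by (simp add: power2_eq_square algebra_simps)
  with \<open>N > 0\<close> have "real N * (x - B) \<le> C" by simp
  with N show False by linarith
qed

text \<open>Abstracts the matrices nu(P_k cap S^n P_l) of a partition with part measures
  \<open>a k\<close>. The inequality \<open>gram\<close> says that a linear combination of
  indicators of translated parts has nonnegative variance. Its indices are pairs so that one index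
  can hold a time number together with a label or a block.\<close>

locale correlation =
  fixes K :: nat and a :: "nat \<Rightarrow> real" and q :: "int \<Rightarrow> nat \<Rightarrow> nat \<Rightarrow> real"
  assumes q_minus: "q (- n) k l = q n l k"
    and q_nonneg: "0 \<le> q n k l"
    and q_le_1: "q n k l \<le> 1"
    and q_row: "k < K \<Longrightarrow> (\<Sum>l<K. q n k l) = a k"
    and a_sum: "(\<Sum>k<K. a k) = 1"
    and gram: "\<And>(I :: (nat \<times> nat) set) c lab t. finite I \<Longrightarrow> (\<Sum>p\<in>I. c p * a (lab p))\<^sup>2 \<le>
      (\<Sum>p\<in>I. \<Sum>r\<in>I. c p * c r * q (t r - t p) (lab p) (lab r))"
begin

lemma a_nonneg: "k < K \<Longrightarrow> 0 \<le> a k"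
  using q_row[of k 0] q_nonneg by (metis sum_nonneg)

text \<open>Apply \<open>gram\<close> to the sum over i < N of the function with value
  \<open>h k\<close> on part k, translated to time \<open>m i\<close>. Every off-diagonal pair of
  times contributes nearly the quadratic form of \<open>Q\<close> at \<open>h\<close>, with error at
  most H^2 \<eta> for each of the K^2 entries. The square on the left expresses positivity even
  after the products \<open>a k * a l\<close> are subtracted from \<open>Q\<close>.\<close>

lemma approx_positive_semidefinite:
  fixes m :: "nat \<Rightarrow> int"
  assumes near: "\<And>i j k l. i < j \<Longrightarrow> k < K \<Longrightarrow> l < K \<Longrightarrow> \<bar>q (m j - m i) k l - Q k l\<bar> \<le> \<eta>"
    and h: "\<And>k. k < K \<Longrightarrow> \<bar>h k\<bar> \<le> H"
  shows "(\<Sum>k<K. h k * a k)\<^sup>2 \<le> (\<Sum>k<K. \<Sum>l<K. h k * h l * Q k l) + (real K * H)\<^sup>2 * \<eta>"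
    (is "?s\<^sup>2 \<le> ?B")
proof -
  define t where "t i j = (\<Sum>k<K. \<Sum>l<K. h k * h l * q (m j - m i) k l)" for i j
  have up: "t i j \<le> ?B" if "i < j" for i j
  proof -
    have "t i j \<le> (\<Sum>k<K. \<Sum>l<K. h k * h l * Q k l + H\<^sup>2 * \<eta>)"
      unfolding t_def
    proof (intro sum_mono)
      fix k l assume kl: "k \<in> {..<K}" "l \<in> {..<K}"
      have "h k * h l * (q (m j - m i) k l - Q k l) \<le> \<bar>h k\<bar> * \<bar>h l\<bar> * \<bar>q (m j - m i) k l - Q k l\<bar>"
        by (metis abs_ge_self abs_mult)
      also have "\<dots> \<le> H * H * \<eta>"
        using kl h[of k] h[of l] near[OF that, of k l] by (intro mult_mono) auto
      finally show "h k * h l * q (m j - m i) k l \<le> h k * h l * Q k l + H\<^sup>2 * \<eta>"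
        by (simp add: algebra_simps power2_eq_square)
    qed
    also have "\<dots> = ?B"
      by (simp add: sum.distrib power2_eq_square algebra_simps)
    finally show ?thesis .
  qed
  \<comment> \<open>\<open>near\<close> controls only pairs with i < j. A change of sign of the time
    transposes \<open>q\<close>, which leaves the form unchanged.\<close>
  have sym: "t i j = t j i" for i j
  proof -
    have "q (m j - m i) k l = q (m i - m j) l k" for k l
      using q_minus[of "m i - m j" k l] by simp
    then have "t i j = (\<Sum>k<K. \<Sum>l<K. h k * h l * q (m i - m j) l k)"
      unfolding t_def by simp
    also have "\<dots> = t j i" unfolding t_def
      by (subst sum.swap) (simp add: mult.commute)
    finally show ?thesis .
  qed
  have off: "t i j \<le> ?B" if "i \<noteq> j" for i j
    using up[of i j] up[of j i] sym[of i j] that by (cases "i < j") auto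
  define C where "C = t 0 0 - ?B"
  have diag: "t i i \<le> ?B + C" for i by (simp add: C_def t_def)
  show ?thesis
  proof (rule le_if_quadratic_growth_le)
    fix N :: nat assume "N > 0"
    have "real N ^ 2 * ?s\<^sup>2 = (\<Sum>p\<in>{..<N} \<times> {..<K}. h (snd p) * a (snd p))\<^sup>2"
      by (simp add: sum.cartesian_product' power_mult_distrib)
    also have "\<dots> \<le> (\<Sum>p\<in>{..<N} \<times> {..<K}. \<Sum>r\<in>{..<N} \<times> {..<K}.
        h (snd p) * h (snd r) * q (m (fst r) - m (fst p)) (snd p) (snd r))"
      by (rule gram) auto
    also have "\<dots> = (\<Sum>i<N. \<Sum>k<K. \<Sum>j<N. \<Sum>l<K. h k * h l * q (m j - m i) k l)"
      by (simp add: sum.cartesian_product')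
    also have "\<dots> = (\<Sum>i<N. \<Sum>j<N. t i j)"
      unfolding t_def by (intro sum.cong refl sum.swap)
    also have "\<dots> \<le> real N ^ 2 * ?B + real N * C"
      by (rule double_sum_le_off_diagonal) (use off diag in auto)
    finally show "real N ^ 2 * ?s\<^sup>2 \<le> real N ^ 2 * ?B + real N * C" .
  qed
qed

text \<open>The averages of the indicator of the part \<open>k\<close> over the times of two far apart blocks nearly
  coincide, so their correlations with the part \<open>l\<close> at a block in between nearly agree; these are
  \<open>Q k l\<close> and \<open>Q l k\<close>.\<close>

lemma approx_symmetric:
  fixes m :: "nat \<Rightarrow> int"
  assumes near: "\<And>i j k l. i < j \<Longrightarrow> k < K \<Longrightarrow> l < K \<Longrightarrow> \<bar>q (m j - m i) k l - Q k l\<bar> \<le> \<eta>"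
    and kl: "k < K" "l < K" and Q: "\<bar>Q k l - Q l k\<bar> \<le> 1"
  shows "(Q k l - Q l k)\<^sup>2 \<le> 8 * \<eta>"
proof -
  have \<eta>: "0 \<le> \<eta>" using near[of 0 1 k l] kl by linarith
  have near': "\<bar>q (m j - m i) x y - Q y x\<bar> \<le> \<eta>" if "j < i" "x < K" "y < K" for i j x y
    using near[of j i y x] that q_minus[of "m i - m j" x y] by simp
  define \<Delta> where "\<Delta> = Q k l - Q l k"
  have "\<Delta>\<^sup>2 \<le> 8 * \<eta>"
  proof (rule le_if_quadratic_growth_le)
    fix N :: nat assume "N > 0"
    \<comment> \<open>Three consecutive blocks of N times: blocks 0 and 2 carry part k with
      coefficients 1 and -1, block 1 carries part l with coefficient -\<Delta>. With this choice the
      cross term of about -2 \<Delta>^2 N^2 outweighs the square \<Delta>^2 \<open>S 1 1\<close>,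
      which is at most \<Delta>^2 N^2.\<close>
    define lab where "lab b = (if b = 1 then l else k)" for b :: nat
    define c where "c b = (if b = 0 then 1 else if b = 1 then - \<Delta> else - 1)" for b :: nat
    define S where "S b d = (\<Sum>i<N. \<Sum>j<N. q (m (d * N + j) - m (b * N + i)) (lab b) (lab d))"
      for b d
    have less: "b * N + i < d * N + j" if "b < d" "i < N" for b d i j
    proof -
      have "b * N + i < Suc b * N" using that by simp
      also have "\<dots> \<le> d * N" using that by (intro mult_right_mono) auto
      finally show ?thesis by simp
    qed
    have lab: "lab b < K" for b using kl by (simp add: lab_def)
    have up: "\<bar>S b d - real N ^ 2 * Q (lab b) (lab d)\<bar> \<le> real N ^ 2 * \<eta>" if "b < d" for b d
    proof -
      have "S b d - real N ^ 2 * Q (lab b) (lab d) =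
        (\<Sum>i<N. \<Sum>j<N. q (m (d * N + j) - m (b * N + i)) (lab b) (lab d) - Q (lab b) (lab d))"
        by (simp add: S_def sum_subtractf power2_eq_square)
      also have "\<bar>\<dots>\<bar> \<le> (\<Sum>i<N. \<Sum>j<N. \<eta>)"
        using near less that lab by (intro order.trans[OF sum_abs] sum_mono) auto
      finally show ?thesis by (simp add: power2_eq_square)
    qed
    have sym: "S d b = S b d" for b d
    proof -
      have "q (m (b * N + j) - m (d * N + i)) x y = q (m (d * N + i) - m (b * N + j)) y x" for i j x y
        using q_minus[of "m (d * N + i) - m (b * N + j)" x y] by simp
      then have "S d b = (\<Sum>i<N. \<Sum>j<N. q (m (d * N + i) - m (b * N + j)) (lab b) (lab d))"
        by (simp add: S_def)
      also have "\<dots> = S b d" unfolding S_def by (rule sum.swap)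
      finally show ?thesis .
    qed
    have diag: "S b b \<le> real N ^ 2 * (Q k k + \<eta>) + real N * (1 - (Q k k + \<eta>))" if "lab b = k" for b
      unfolding S_def
    proof (rule double_sum_le_off_diagonal)
      fix i j :: nat assume "i \<noteq> j"
      then have "\<bar>q (m (b * N + j) - m (b * N + i)) k k - Q k k\<bar> \<le> \<eta>"
        using near[of "b * N + i" "b * N + j"] near'[of "b * N + j" "b * N + i"] kl
        by (cases "i < j") auto
      then show "q (m (b * N + j) - m (b * N + i)) (lab b) (lab b) \<le> Q k k + \<eta>"
        by (simp add: that)
    qed (simp add: q_le_1)
    have "S 1 1 \<le> (\<Sum>i<N. \<Sum>j<N. 1)" unfolding S_def by (intro sum_mono q_le_1)
    then have "S 1 1 \<le> real N ^ 2" by (simp add: power2_eq_square)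
    then have S11: "\<Delta>\<^sup>2 * S 1 1 \<le> \<Delta>\<^sup>2 * real N ^ 2" by (rule mult_left_mono) simp
    have "0 \<le> (\<Sum>p\<in>{..<N} \<times> {..<3}. c (snd p) * a (lab (snd p)))\<^sup>2" by simp
    also have "\<dots> \<le> (\<Sum>p\<in>{..<N} \<times> {..<3}. \<Sum>r\<in>{..<N} \<times> {..<3}. c (snd p) * c (snd r) *
        q (m (snd r * N + fst r) - m (snd p * N + fst p)) (lab (snd p)) (lab (snd r)))"
      by (rule gram) auto
    also have "\<dots> = (\<Sum>i<N. \<Sum>b<3. \<Sum>j<N. \<Sum>d<3. c b * c d *
        q (m (d * N + j) - m (b * N + i)) (lab b) (lab d))"
      by (simp add: sum.cartesian_product')
    also have "\<dots> = (\<Sum>b<3. \<Sum>i<N. \<Sum>d<3. \<Sum>j<N. c b * c d *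
        q (m (d * N + j) - m (b * N + i)) (lab b) (lab d))"
      by (subst sum.swap) (intro sum.cong refl sum.swap)
    also have "\<dots> = (\<Sum>b<3. \<Sum>d<3. c b * c d * S b d)"
      unfolding S_def sum_distrib_left by (intro sum.cong refl sum.swap)
    also have "\<dots> = S 0 0 + S 2 2 - 2 * S 0 2 - 2 * \<Delta> * (S 0 1 - S 1 2) + \<Delta>\<^sup>2 * S 1 1"
      using sym[of 0 1] sym[of 0 2] sym[of 1 2]
      by (simp add: numeral_3_eq_3 lessThan_Suc c_def algebra_simps power2_eq_square numeral_2_eq_2)
    finally have main: "0 \<le> \<dots>" .
    \<comment> \<open>The asymmetry enters here: from block 0 to block 1 the labels run from k to l,
      from block 1 to block 2 from l to k.\<close>
    have "S 0 1 - S 1 2 = real N ^ 2 * \<Delta> + ((S 0 1 - real N ^ 2 * Q k l) - (S 1 2 - real N ^ 2 * Q l k))"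
      by (simp add: \<Delta>_def algebra_simps)
    moreover have "\<bar>(S 0 1 - real N ^ 2 * Q k l) - (S 1 2 - real N ^ 2 * Q l k)\<bar> \<le> 2 * (real N ^ 2 * \<eta>)"
      using up[of 0 1] up[of 1 2] by (simp add: lab_def)
    moreover define z where "z = (S 0 1 - real N ^ 2 * Q k l) - (S 1 2 - real N ^ 2 * Q l k)"
    ultimately have z: "S 0 1 - S 1 2 = real N ^ 2 * \<Delta> + z" "\<bar>z\<bar> \<le> 2 * (real N ^ 2 * \<eta>)" by auto
    have "\<bar>\<Delta> * z\<bar> \<le> 1 * (2 * (real N ^ 2 * \<eta>))"
      unfolding abs_mult using Q z(2) by (intro mult_mono) (auto simp: \<Delta>_def)
    then have dz: "- (\<Delta> * z) \<le> 2 * (real N ^ 2 * \<eta>)" by linarith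
    have "\<Delta> * (S 0 1 - S 1 2) = \<Delta>\<^sup>2 * real N ^ 2 + \<Delta> * z"
      unfolding z(1) by (simp add: algebra_simps power2_eq_square)
    moreover have "S 0 2 \<ge> real N ^ 2 * Q k k - real N ^ 2 * \<eta>"
      using up[of 0 2] by (simp add: lab_def abs_le_iff)
    \<comment> \<open>The constant 8: up to linear terms \<open>S 0 0 + S 2 2 - 2 * S 0 2\<close>
      costs 4 \<eta> N^2, and the error of the cross term costs another 4 \<eta> N^2.\<close>
    ultimately show "real N ^ 2 * \<Delta>\<^sup>2 \<le> real N ^ 2 * (8 * \<eta>) + real N * (2 * (1 - (Q k k + \<eta>)))"
      using main S11 dz diag[of 0] diag[of 2] by (simp add: lab_def algebra_simps)
  qed
  then show ?thesis by (simp add: \<Delta>_def)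
qed

end

text \<open>The first condition says that \<open>Q\<close> minus the products
  \<open>a k * a l\<close> is nearly positive semidefinite. The error is absolute, hence the bound
  \<open>H\<close> on the test vectors.\<close>

definition almost_symmetric_psd ::
    "nat \<Rightarrow> (nat \<Rightarrow> real) \<Rightarrow> (nat \<Rightarrow> nat \<Rightarrow> real) \<Rightarrow> real \<Rightarrow> real \<Rightarrow> bool" where
  "almost_symmetric_psd K a Q H \<eta> \<longleftrightarrow>
     (\<forall>h. (\<forall>k<K. \<bar>h k\<bar> \<le> H) \<longrightarrow> (\<Sum>k<K. h k * a k)\<^sup>2 \<le> (\<Sum>k<K. \<Sum>l<K. h k * h l * Q k l) + \<eta>) \<and>
     (\<forall>k<K. \<forall>l<K. \<bar>Q k l - Q l k\<bar> \<le> \<eta>)"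

section \<open>Times along whose differences the correlations are almost constant\<close>

lemma exists_avoiding_differences:
  assumes "\<not> syndetic R"
  shows "\<exists>m :: nat \<Rightarrow> int. \<forall>i j. i < j \<longrightarrow> m j - m i \<notin> R"
proof -
  have "\<exists>f :: nat \<Rightarrow> int. \<forall>j. \<forall>i<j. f j - f i \<notin> R"
  proof (rule dependent_wellorder_choice)
    fix j :: nat and f :: "nat \<Rightarrow> int"
    \<comment> \<open>\<open>R\<close> misses intervals of every length. In such an interval of
      length 2 B + 1 starting at M, the centre M + B differs from every earlier time, of absolute
      value at most B, by an element of the interval.\<close>
    define B where "B = (\<Sum>i<j. \<bar>f i\<bar>)"
    have B: "\<bar>f i\<bar> \<le> B" if "i < j" for i
      unfolding B_def using that by (intro member_le_sum) auto
    have "B \<ge> 0" by (simp add: B_def sum_nonneg)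
    then obtain M where M: "R \<inter> {M..<M + (2 * B + 1)} = {}"
      using assms unfolding syndetic_def by (metis add_nonneg_pos mult_nonneg_nonneg zero_le_numeral zero_less_one)
    have "M + B - f i \<notin> R" if "i < j" for i
      using M B[OF that] by (auto simp: abs_le_iff)
    then show "\<exists>r. \<forall>i<j. r - f i \<notin> R" by blast
  qed auto
  then show ?thesis by blast
qed

text \<open>Ramsey's theorem for pairs: i < j is coloured by the matrix at \<open>m j - m i\<close>
  with entries rounded down to multiples of \<eta>. Entries lie in [0, 1], so there are finitely
  many colours.\<close>

lemma subsequence_with_almost_constant_differences:
  fixes q :: "int \<Rightarrow> nat \<Rightarrow> nat \<Rightarrow> real" and m :: "nat \<Rightarrow> int"
  assumes q: "\<And>n k l. 0 \<le> q n k l" "\<And>n k l. q n k l \<le> 1" and \<eta>: "\<eta> > 0"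
  shows "\<exists>f :: nat \<Rightarrow> nat. strict_mono f \<and> (\<forall>i j i' j' k l. i < j \<longrightarrow> i' < j' \<longrightarrow> k < K \<longrightarrow> l < K \<longrightarrow>
    \<bar>q (m (f j) - m (f i)) k l - q (m (f j') - m (f i')) k l\<bar> \<le> \<eta>)"
proof -
  define V where "V = ({..<K} \<times> {..<K}) \<rightarrow>\<^sub>E {..nat \<lfloor>1 / \<eta>\<rfloor>}"
  define v where "v n = restrict (\<lambda>(k, l). nat \<lfloor>q n k l / \<eta>\<rfloor>) ({..<K} \<times> {..<K})" for n
  have v: "v n \<in> V" for n
    unfolding v_def V_def
    by (auto simp: PiE_iff intro!: nat_mono floor_mono divide_right_mono q less_imp_le[OF \<eta>])
  have "finite V" unfolding V_def by (intro finite_PiE) auto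
  then obtain b where b: "bij_betw b V {0..<card V}"
    using ex_bij_betw_finite_nat by blast
  \<comment> \<open>\<open>Ramsey2\<close> colours unordered pairs by natural numbers below a bound.
    Hence \<open>b\<close> numbers the rounded matrices, and \<open>Min\<close> and
    \<open>Max\<close> recover the order of the pair.\<close>
  define col where "col e = b (v (m (Max e) - m (Min e)))" for e :: "nat set"
  have "\<exists>Y t. Y \<subseteq> UNIV \<and> infinite Y \<and> t < card V \<and> (\<forall>x\<in>Y. \<forall>y\<in>Y. x \<noteq> y \<longrightarrow> col {x, y} = t)"
  proof (rule Ramsey2)
    show "\<forall>x\<in>UNIV. \<forall>y\<in>UNIV. x \<noteq> y \<longrightarrow> col {x, y} < card V"
      using bij_betwE[OF b] v by (auto simp: col_def)
  qed simp
  then obtain Y t where Y: "infinite Y" "\<forall>x\<in>Y. \<forall>y\<in>Y. x \<noteq> y \<longrightarrow> col {x, y} = t"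
    by meson
  define f where "f = enumerate Y"
  have f: "strict_mono f" unfolding f_def using Y(1) by (rule strict_mono_enumerate)
  have "b (v (m (f j) - m (f i))) = t" if "i < j" for i j
  proof -
    have "f i < f j" using f that by (rule strict_monoD)
    moreover have "f i \<in> Y" "f j \<in> Y" using Y(1) by (simp_all add: f_def enumerate_in_set)
    ultimately show ?thesis using Y(2)[rule_format, of "f i" "f j"] by (simp add: col_def)
  qed
  then have same: "v (m (f j) - m (f i)) = v (m (f j') - m (f i'))" if "i < j" "i' < j'" for i j i' j'
    using that v bij_betw_imp_inj_on[OF b] by (metis inj_onD)
  have "\<bar>q (m (f j) - m (f i)) k l - q (m (f j') - m (f i')) k l\<bar> \<le> \<eta>"
    if "i < j" "i' < j'" "k < K" "l < K" for i j i' j' k l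
  proof -
    define x y where "x = q (m (f j) - m (f i)) k l / \<eta>" and "y = q (m (f j') - m (f i')) k l / \<eta>"
    have "nat \<lfloor>x\<rfloor> = nat \<lfloor>y\<rfloor>"
      using fun_cong[OF same[OF that(1,2)], of "(k, l)"] that(3,4) by (simp add: v_def x_def y_def)
    moreover have "x \<ge> 0" "y \<ge> 0" using q \<eta> by (simp_all add: x_def y_def)
    ultimately have "\<lfloor>x\<rfloor> = \<lfloor>y\<rfloor>" by (simp add: nat_eq_iff)
    then have "\<bar>x - y\<bar> \<le> 1" by linarith
    then have "\<eta> * \<bar>x - y\<bar> \<le> \<eta>" using \<eta> by simp
    moreover have "q (m (f j) - m (f i)) k l - q (m (f j') - m (f i')) k l = \<eta> * (x - y)"
      using \<eta> by (simp add: x_def y_def field_simps)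
    ultimately show ?thesis using \<eta> by (simp add: abs_mult)
  qed
  then show ?thesis by (intro exI[of _ f] conjI allI impI f)
qed

lemma (in correlation) almost_symmetric_psd_if_almost_constant:
  fixes m :: "nat \<Rightarrow> int"
  assumes near: "\<And>i j k l. i < j \<Longrightarrow> k < K \<Longrightarrow> l < K \<Longrightarrow> \<bar>q (m j - m i) k l - q n k l\<bar> \<le> \<eta>'"
    and "(real K * H)\<^sup>2 * \<eta>' \<le> \<eta>" and "8 * \<eta>' \<le> \<eta>\<^sup>2" and "\<eta> \<ge> 0"
  shows "almost_symmetric_psd K a (q n) H \<eta>"
  unfolding almost_symmetric_psd_def
proof (intro conjI allI impI)
  fix h :: "nat \<Rightarrow> real" assume "\<forall>k<K. \<bar>h k\<bar> \<le> H"
  then show "(\<Sum>k<K. h k * a k)\<^sup>2 \<le> (\<Sum>k<K. \<Sum>l<K. h k * h l * q n k l) + \<eta>"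
    using approx_positive_semidefinite[of m "q n" \<eta>' h H] near assms(2) by fastforce
next
  fix k l assume kl: "k < K" "l < K"
  have "\<bar>q n k l - q n l k\<bar> \<le> 1"
    using q_nonneg[of n k l] q_nonneg[of n l k] q_le_1[of n k l] q_le_1[of n l k] by linarith
  then have "(q n k l - q n l k)\<^sup>2 \<le> \<eta>\<^sup>2"
    using approx_symmetric[of m "q n" \<eta>' k l] near kl assms(3) by fastforce
  then show "\<bar>q n k l - q n l k\<bar> \<le> \<eta>"
    using \<open>\<eta> \<ge> 0\<close> by (metis abs_le_square_iff abs_of_nonneg)
qed

text \<open>Refine the sequence first for \<open>q1\<close>, then for \<open>q2\<close>; the second
  refinement keeps the property gained in the first. Every difference along the result then has the
  required properties, and the first one is taken.\<close>

lemma exists_almost_symmetric_psd_time: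
  assumes c1: "correlation K1 a1 q1" and c2: "correlation K2 a2 q2"
    and R: "\<not> syndetic R" and \<eta>: "\<eta> > 0"
  shows "\<exists>n. n \<notin> R \<and> almost_symmetric_psd K1 a1 (q1 n) H \<eta> \<and> almost_symmetric_psd K2 a2 (q2 n) H \<eta>"
proof -
  define D where "D = (real K1 * H)\<^sup>2 + (real K2 * H)\<^sup>2 + 1"
  \<comment> \<open>The first bound serves the asymmetry, whose square is at most 8 \<eta>'; the
    second serves the error (K H)^2 \<eta>' of both quadratic forms.\<close>
  define \<eta>' where "\<eta>' = min (\<eta>\<^sup>2 / 8) (\<eta> / D)"
  have D: "D > 0" unfolding D_def by (intro add_nonneg_pos add_nonneg_nonneg) auto
  have \<eta>': "\<eta>' > 0" "8 * \<eta>' \<le> \<eta>\<^sup>2" "D * \<eta>' \<le> \<eta>"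
    using \<eta> D by (auto simp: \<eta>'_def min_def field_simps)
  have small: "(real K1 * H)\<^sup>2 * \<eta>' \<le> \<eta>" "(real K2 * H)\<^sup>2 * \<eta>' \<le> \<eta>"
    using \<eta>'(1) by (auto intro!: order.trans[OF mult_right_mono \<eta>'(3)] simp: D_def)
  obtain m :: "nat \<Rightarrow> int" where m: "\<And>i j. i < j \<Longrightarrow> m j - m i \<notin> R"
    using exists_avoiding_differences[OF R] by blast
  obtain f :: "nat \<Rightarrow> nat" where f: "strict_mono f \<and> (\<forall>i j i' j' k l. i < j \<longrightarrow> i' < j' \<longrightarrow> k < K1 \<longrightarrow> l < K1 \<longrightarrow>
      \<bar>q1 (m (f j) - m (f i)) k l - q1 (m (f j') - m (f i')) k l\<bar> \<le> \<eta>')"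
    using subsequence_with_almost_constant_differences[where m = m and K = K1,
      OF correlation.q_nonneg[OF c1] correlation.q_le_1[OF c1] \<eta>'(1)] by (rule exE)
  obtain g :: "nat \<Rightarrow> nat" where g: "strict_mono g \<and> (\<forall>i j i' j' k l. i < j \<longrightarrow> i' < j' \<longrightarrow> k < K2 \<longrightarrow> l < K2 \<longrightarrow>
      \<bar>q2 (m (f (g j)) - m (f (g i))) k l - q2 (m (f (g j')) - m (f (g i'))) k l\<bar> \<le> \<eta>')"
    using subsequence_with_almost_constant_differences[where m = "\<lambda>i. m (f i)" and K = K2,
      OF correlation.q_nonneg[OF c2] correlation.q_le_1[OF c2] \<eta>'(1)] by (rule exE)
  define p where "p i = m (f (g i))" for i
  define n where "n = p 1 - p 0"
  have "n \<notin> R"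
    unfolding n_def p_def by (intro m strict_monoD[OF conjunct1[OF f]] strict_monoD[OF conjunct1[OF g]]) simp
  moreover have "almost_symmetric_psd K1 a1 (q1 n) H \<eta>"
    by (rule correlation.almost_symmetric_psd_if_almost_constant[OF c1, of p n \<eta>'])
       (use conjunct2[OF f, rule_format] strict_monoD[OF conjunct1[OF g]] \<eta>' small \<eta> in \<open>auto simp: p_def n_def\<close>)
  moreover have "almost_symmetric_psd K2 a2 (q2 n) H \<eta>"
    by (rule correlation.almost_symmetric_psd_if_almost_constant[OF c2, of p n \<eta>'])
       (use conjunct2[OF g, rule_format] \<eta>' small \<eta> in \<open>auto simp: p_def n_def\<close>)
  ultimately show ?thesis by blast
qed

section \<open>The trilinear form of two nearly symmetric positive matrices\<close>

text \<open>Test positivity on the vector \<open>h = g / (Q g / a + \<tau>)\<close>: since \<open>2 / (E k * E l) \<le> 1 / (E k)\<^sup>2 + 1 / (E l)\<^sup>2\<close>,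
  near symmetry bounds the quadratic form at \<open>h\<close> by the linear form \<open>s = (\<Sum>k<K. a k * h k)\<close>, and
  \<open>s\<^sup>2 \<le> s + error\<close> gives \<open>s \<le> 1 + error\<close>. Where \<open>a k = 0\<close>, also \<open>Q k l = 0\<close> and the junk value of the quotient is harmless.\<close>

lemma sum_ratio_le:
  fixes a g :: "nat \<Rightarrow> real" and Q :: "nat \<Rightarrow> nat \<Rightarrow> real"
  assumes Q: "\<And>k l. 0 \<le> Q k l" and row: "\<And>k. k < K \<Longrightarrow> (\<Sum>l<K. Q k l) = a k"
    and g: "\<And>k. g k = 0 \<or> g k = 1" and \<tau>: "\<tau> > 0" and \<eta>: "\<eta> \<ge> 0"
    and psd: "almost_symmetric_psd K a Q (1 / \<tau>) \<eta>"
  shows "(\<Sum>k<K. a k * (g k / ((\<Sum>l<K. Q k l * g l) / a k + \<tau>))) \<le> 1 + (\<eta> + (real K / \<tau>)\<^sup>2 * \<eta>)"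
proof -
  define r where "r k = (\<Sum>l<K. Q k l * g l)" for k
  define E where "E k = r k / a k + \<tau>" for k
  define h where "h k = g k / E k" for k
  define s where "s = (\<Sum>k<K. h k * a k)"
  define e where "e = \<eta> + (real K / \<tau>)\<^sup>2 * \<eta>"
  have a: "0 \<le> a k" if "k < K" for k using row[OF that] Q by (metis sum_nonneg)
  have g01: "0 \<le> g k" "g k \<le> 1" for k using g[of k] by auto
  have r0: "0 \<le> r k" for k unfolding r_def by (intro sum_nonneg mult_nonneg_nonneg Q g01)
  have ra: "r k \<le> a k" if "k < K" for k
    unfolding r_def row[OF that, symmetric] by (intro sum_mono mult_left_le Q g01)
  have r_eq: "r k = a k * (E k - \<tau>)" if "k < K" for k
    using ra[OF that] r0[of k] by (cases "a k = 0") (auto simp: E_def)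
  have E: "\<tau> \<le> E k" if "k < K" for k using a[OF that] r0[of k] by (simp add: E_def)
  have E0: "0 < E k" if "k < K" for k using E[OF that] \<tau> by linarith
  have h0: "0 \<le> h k" if "k < K" for k using g01[of k] E0[OF that] by (simp add: h_def)
  have hH: "h k \<le> 1 / \<tau>" if "k < K" for k
    unfolding h_def using g01[of k] E[OF that] \<tau> by (intro frac_le) auto
  have "s\<^sup>2 \<le> (\<Sum>k<K. \<Sum>l<K. h k * h l * Q k l) + \<eta>"
    using psd h0 hH unfolding almost_symmetric_psd_def s_def by simp
  also have "(\<Sum>k<K. \<Sum>l<K. h k * h l * Q k l) \<le>
    (\<Sum>k<K. \<Sum>l<K. (Q k l * g l * (g k / (E k)\<^sup>2) + Q l k * g k * (g l / (E l)\<^sup>2) + \<eta> / \<tau>\<^sup>2) / 2)"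
  proof (intro sum_mono)
    fix k l assume kl': "k \<in> {..<K}" "l \<in> {..<K}"
    then have kl: "k < K" "l < K" by auto
    have gg: "0 \<le> g k * g l" "g k * g l \<le> 1" using g01 by (auto intro: mult_le_one)
    have "2 * (1 / E k) * (1 / E l) \<le> (1 / E k)\<^sup>2 + (1 / E l)\<^sup>2" by (rule sum_squares_bound)
    then have 1: "2 * (g k * g l * Q k l) * (1 / E k * (1 / E l)) \<le>
        (g k * g l * Q k l) * ((1 / E k)\<^sup>2 + (1 / E l)\<^sup>2)"
      using mult_left_mono[of "2 * (1 / E k) * (1 / E l)" "(1 / E k)\<^sup>2 + (1 / E l)\<^sup>2" "g k * g l * Q k l",
        OF _ mult_nonneg_nonneg[OF gg(1) Q]] by (simp add: algebra_simps)
    have "Q k l \<le> Q l k + \<eta>" using psd kl unfolding almost_symmetric_psd_def by (smt (verit))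
    then have "(g k * g l * (1 / E l)\<^sup>2) * Q k l \<le> (g k * g l * (1 / E l)\<^sup>2) * (Q l k + \<eta>)"
      using gg by (intro mult_left_mono) auto
    also have "\<dots> = g k * g l * (1 / E l)\<^sup>2 * Q l k + (g k * g l) * (1 / E l)\<^sup>2 * \<eta>"
      by (simp add: algebra_simps)
    also have "(g k * g l) * (1 / E l)\<^sup>2 * \<eta> \<le> 1 * (1 / \<tau>)\<^sup>2 * \<eta>"
      using gg E[OF kl(2)] \<tau> \<eta> by (intro mult_mono mult_right_mono power_mono frac_le) auto
    finally show "h k * h l * Q k l \<le>
      (Q k l * g l * (g k / (E k)\<^sup>2) + Q l k * g k * (g l / (E l)\<^sup>2) + \<eta> / \<tau>\<^sup>2) / 2"
      using 1 by (simp add: h_def power_divide algebra_simps)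
  qed
  also have "\<dots> = ((\<Sum>k<K. \<Sum>l<K. Q k l * g l * (g k / (E k)\<^sup>2)) +
      (\<Sum>k<K. \<Sum>l<K. Q l k * g k * (g l / (E l)\<^sup>2)) + (real K)\<^sup>2 * (\<eta> / \<tau>\<^sup>2)) / 2"
    by (simp add: sum.distrib power2_eq_square flip: sum_divide_distrib)
  \<comment> \<open>Exchanging k and l turns the second sum into the first, which cancels the factor
    1/2.\<close>
  also have "(\<Sum>k<K. \<Sum>l<K. Q l k * g k * (g l / (E l)\<^sup>2)) = (\<Sum>k<K. \<Sum>l<K. Q k l * g l * (g k / (E k)\<^sup>2))"
    by (rule sum.swap)
  also have "(\<Sum>k<K. \<Sum>l<K. Q k l * g l * (g k / (E k)\<^sup>2)) = (\<Sum>k<K. r k * (g k / (E k)\<^sup>2))"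
    by (simp add: r_def sum_distrib_right sum_divide_distrib)
  also have "(\<Sum>k<K. r k * (g k / (E k)\<^sup>2)) \<le> s"
    unfolding s_def
  proof (intro sum_mono)
    fix k assume "k \<in> {..<K}"
    then have k: "k < K" by simp
    \<comment> \<open>Since \<open>r k = a k * (E k - \<tau>)\<close>, dropping \<tau> cancels one
      factor \<open>E k\<close>.\<close>
    have "r k * (g k / (E k)\<^sup>2) = (a k * g k) * ((E k - \<tau>) / (E k)\<^sup>2)"
      using r_eq[OF k] by simp
    also have "\<dots> \<le> (a k * g k) * (1 / E k)"
      using a[OF k] g01[of k] E0[OF k] \<tau>
      by (intro mult_left_mono) (auto simp: power2_eq_square divide_simps)
    finally show "r k * (g k / (E k)\<^sup>2) \<le> h k * a k" by (simp add: h_def mult.commute)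
  qed
  finally have "s\<^sup>2 \<le> s + (real K)\<^sup>2 * (\<eta> / \<tau>\<^sup>2) / 2 + \<eta>" by (simp add: add_divide_distrib)
  moreover have "(real K)\<^sup>2 * (\<eta> / \<tau>\<^sup>2) \<ge> 0" using \<eta> by simp
  moreover have "e = \<eta> + (real K)\<^sup>2 * (\<eta> / \<tau>\<^sup>2)" by (simp add: e_def power_divide)
  moreover have "s\<^sup>2 \<le> s + e" if "s\<^sup>2 \<le> s + w / 2 + \<eta>" "0 \<le> w" "e = \<eta> + w" for w
    using that by linarith
  ultimately have "s\<^sup>2 \<le> s + e" by blast
  then have le: "s * s \<le> s + e" by (simp add: power2_eq_square)
  have e0: "e \<ge> 0" using \<eta> by (simp add: e_def)
  have "s \<le> 1 + e"
  proof (rule ccontr)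
    assume "\<not> s \<le> 1 + e"
    then have s: "s > 1 + e" by simp
    then have "e * 1 \<le> e * s" using e0 by (intro mult_left_mono) auto
    moreover have "(1 + e) * s < s * s" using s e0 by (intro mult_strict_right_mono) auto
    ultimately show False using le by (simp add: algebra_simps)
  qed
  then show ?thesis
    by (simp add: s_def h_def E_def r_def e_def mult.commute)
qed

text \<open>AM-GM for the three terms on the right, whose product is d^6. With p = sqrt (x y) and x
  + y >= 2 p it reduces to p (p - d)^2 (p + 2 d) >= 0.\<close>

lemma am_gm_cube:
  fixes x y d :: real
  assumes "x > 0" "y > 0" "d \<ge> 0"
  shows "3 * d\<^sup>2 \<le> x * y + d ^ 3 * (1 / x) + d ^ 3 * (1 / y)"
proof -
  define p where "p = sqrt (x * y)"
  have p: "p > 0" "p\<^sup>2 = x * y" using assms by (simp_all add: p_def)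
  have "2 * p \<le> x + y"
    using arith_geo_mean_sqrt[of x y] assms by (simp add: p_def)
  then have 1: "d ^ 3 * (2 * p) \<le> d ^ 3 * (x + y)" using assms by (intro mult_left_mono) auto
  have "0 \<le> p * (p - d)\<^sup>2 * (p + 2 * d)" using p assms by simp
  also have "\<dots> = p\<^sup>2 * p\<^sup>2 + d ^ 3 * (2 * p) - 3 * d\<^sup>2 * p\<^sup>2"
    by (simp add: algebra_simps power2_eq_square power3_eq_cube)
  finally have "3 * d\<^sup>2 * (x * y) \<le> (x * y) * (x * y) + d ^ 3 * (x + y)" using 1 p(2) by simp
  then show ?thesis using assms
    by (simp add: field_simps)
qed

text \<open>Here \<open>r1 k l / a k\<close> and \<open>r2 k l / b l\<close> stand for Q_1 f and Q_2
  f on a grid cell, raised by \<tau> to keep reciprocals bounded. Integrating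
  \<open>am_gm_cube\<close> over the set with indicator \<open>g\<close>, of measure d, bounds 3 d^3
  by the trilinear form plus 2 d^3 (1 + e) + 3 \<tau>.\<close>

lemma triple_form_ge_cube:
  fixes a b :: "nat \<Rightarrow> real" and g r1 r2 :: "nat \<Rightarrow> nat \<Rightarrow> real"
  assumes a: "\<And>k. k < K \<Longrightarrow> 0 \<le> a k" "(\<Sum>k<K. a k) = 1"
    and b: "\<And>l. l < L \<Longrightarrow> 0 \<le> b l" "(\<Sum>l<L. b l) = 1"
    and g: "\<And>k l. g k l = 0 \<or> g k l = 1"
    and r1: "\<And>k l. k < K \<Longrightarrow> l < L \<Longrightarrow> 0 \<le> r1 k l \<and> r1 k l \<le> a k"
    and r2: "\<And>k l. k < K \<Longrightarrow> l < L \<Longrightarrow> 0 \<le> r2 k l \<and> r2 k l \<le> b l"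
    and \<tau>: "0 < \<tau>" "\<tau> \<le> 1" and e: "e \<ge> 0"
    and s1: "\<And>l. l < L \<Longrightarrow> (\<Sum>k<K. a k * (g k l / (r1 k l / a k + \<tau>))) \<le> 1 + e"
    and s2: "\<And>k. k < K \<Longrightarrow> (\<Sum>l<L. b l * (g k l / (r2 k l / b l + \<tau>))) \<le> 1 + e"
  shows "(\<Sum>k<K. \<Sum>l<L. a k * b l * g k l) ^ 3 - 2 * e - 3 * \<tau> \<le> (\<Sum>k<K. \<Sum>l<L. g k l * r1 k l * r2 k l)"
proof -
  define d where "d = (\<Sum>k<K. \<Sum>l<L. a k * b l * g k l)"
  have g01: "0 \<le> g k l" "g k l \<le> 1" for k l using g[of k l] by auto
  have d0: "0 \<le> d" unfolding d_def using a b g01 by (intro sum_nonneg) auto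
  have total: "(\<Sum>k<K. \<Sum>l<L. a k * b l) = 1"
    using a(2) b(2) by (simp flip: sum_distrib_left)
  have d1: "d \<le> 1"
    unfolding total[symmetric] d_def using a b g01 by (intro sum_mono mult_left_le) auto
  define E where "E k l = r1 k l / a k + \<tau>" for k l
  define G where "G k l = r2 k l / b l + \<tau>" for k l
  have pos: "E k l > 0" "G k l > 0" if "k < K" "l < L" for k l
    using that a(1) b(1) r1 r2 \<tau> by (auto simp: E_def G_def intro!: add_nonneg_pos)
  \<comment> \<open>If \<open>a k = 0\<close>, the bounds on \<open>r1 k l\<close> force it to be 0,
    so the equation survives division by zero.\<close>
  have E: "a k * E k l = r1 k l + \<tau> * a k" if "k < K" "l < L" for k l
    using r1[OF that] by (cases "a k = 0") (auto simp: E_def algebra_simps)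
  have G: "b l * G k l = r2 k l + \<tau> * b l" if "k < K" "l < L" for k l
    using r2[OF that] by (cases "b l = 0") (auto simp: G_def algebra_simps)
  have "3 * d\<^sup>2 * d = (\<Sum>k<K. \<Sum>l<L. (a k * b l * g k l) * (3 * d\<^sup>2))"
    unfolding d_def by (simp flip: sum_distrib_right)
  also have "\<dots> \<le> (\<Sum>k<K. \<Sum>l<L. (a k * b l * g k l) *
      (E k l * G k l + d ^ 3 * (1 / E k l) + d ^ 3 * (1 / G k l)))"
    using a b g01 pos d0 by (intro sum_mono mult_left_mono am_gm_cube) auto
  also have "\<dots> = (\<Sum>k<K. \<Sum>l<L. g k l * (a k * E k l) * (b l * G k l)) +
      d ^ 3 * (\<Sum>k<K. \<Sum>l<L. b l * (a k * (g k l / E k l))) +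
      d ^ 3 * (\<Sum>k<K. \<Sum>l<L. a k * (b l * (g k l / G k l)))"
    by (simp add: sum.distrib sum_distrib_left algebra_simps)
  also have "(\<Sum>k<K. \<Sum>l<L. b l * (a k * (g k l / E k l))) = (\<Sum>l<L. b l * (\<Sum>k<K. a k * (g k l / E k l)))"
    by (subst sum.swap) (simp add: sum_distrib_left)
  also have "\<dots> \<le> (\<Sum>l<L. b l * (1 + e))"
    using b s1 by (intro sum_mono mult_left_mono) (auto simp: E_def)
  also have "\<dots> = 1 + e" using b by (simp flip: sum_distrib_right)
  also have "(\<Sum>k<K. \<Sum>l<L. a k * (b l * (g k l / G k l))) \<le> (\<Sum>k<K. a k * (1 + e))"
    unfolding sum_distrib_left[symmetric]
    using a s2 by (intro sum_mono mult_left_mono) (auto simp: G_def)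
  also have "\<dots> = 1 + e" using a by (simp flip: sum_distrib_right)
  \<comment> \<open>Removing \<tau> from both factors leaves three extra products, each at most
    \<tau> times the measure of the cell.\<close>
  also have "(\<Sum>k<K. \<Sum>l<L. g k l * (a k * E k l) * (b l * G k l)) \<le>
      (\<Sum>k<K. \<Sum>l<L. g k l * r1 k l * r2 k l + 3 * \<tau> * (a k * b l))"
  proof (intro sum_mono)
    fix k l assume "k \<in> {..<K}" "l \<in> {..<L}"
    then have kl: "k < K" "l < L" by auto
    have ab: "0 \<le> a k" "0 \<le> b l" using a b kl by auto
    have "r1 k l * (\<tau> * b l) \<le> a k * (\<tau> * b l)" "(\<tau> * a k) * r2 k l \<le> (\<tau> * a k) * b l"
      using r1[OF kl] r2[OF kl] ab \<tau> by (auto intro!: mult_right_mono mult_left_mono)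
    moreover have "(\<tau> * a k) * (\<tau> * b l) \<le> 1 * a k * (\<tau> * b l)"
      using ab \<tau> by (intro mult_right_mono) auto
    ultimately have "\<tau> * (r1 k l * b l + a k * r2 k l + \<tau> * (a k * b l)) \<le> 3 * \<tau> * (a k * b l)"
      by (simp add: algebra_simps)
    moreover have "g k l * (\<tau> * (r1 k l * b l + a k * r2 k l + \<tau> * (a k * b l))) \<le>
        1 * (\<tau> * (r1 k l * b l + a k * r2 k l + \<tau> * (a k * b l)))"
      using g01 ab r1[OF kl] r2[OF kl] \<tau> by (intro mult_right_mono) auto
    ultimately show "g k l * (a k * E k l) * (b l * G k l) \<le> g k l * r1 k l * r2 k l + 3 * \<tau> * (a k * b l)"
      unfolding E[OF kl] G[OF kl] by (simp add: algebra_simps)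
  qed
  also have "\<dots> = (\<Sum>k<K. \<Sum>l<L. g k l * r1 k l * r2 k l) + 3 * \<tau>"
    using total by (simp add: sum.distrib flip: sum_distrib_left)
  finally have "3 * d\<^sup>2 * d \<le> (\<Sum>k<K. \<Sum>l<L. g k l * r1 k l * r2 k l) + 3 * \<tau> +
      d ^ 3 * (1 + e) + d ^ 3 * (1 + e)"
    using d0 by (simp add: mult_left_mono)
  moreover have "d ^ 3 * e \<le> 1 * e" using d0 d1 e by (intro mult_right_mono power_le_one) auto
  moreover have "3 * d\<^sup>2 * d = 3 * d ^ 3" by (simp add: power2_eq_square power3_eq_cube)
  ultimately have "d ^ 3 - 2 * e - 3 * \<tau> \<le> (\<Sum>k<K. \<Sum>l<L. g k l * r1 k l * r2 k l)"
    by (simp add: algebra_simps)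
  then show ?thesis by (simp add: d_def)
qed

section \<open>Measure preserving actions of the integers\<close>

text \<open>The two sides are the squared mean and the second moment of the weighted sum of the
  indicators of \<open>E p\<close>; their difference is a variance.\<close>

lemma (in prob_space) weighted_prob_sum_square_le:
  fixes c :: "'i \<Rightarrow> real"
  assumes I: "finite I" and E: "\<And>p. p \<in> I \<Longrightarrow> E p \<in> events"
  shows "(\<Sum>p\<in>I. c p * prob (E p))\<^sup>2 \<le> (\<Sum>p\<in>I. \<Sum>r\<in>I. c p * c r * prob (E p \<inter> E r))"
proof -
  define X where "X x = (\<Sum>p\<in>I. c p * indicator (E p) x)" for x
  have sq: "(X x)\<^sup>2 = (\<Sum>p\<in>I. \<Sum>r\<in>I. c p * c r * indicator (E p \<inter> E r) x)" for x
    by (simp add: X_def power2_eq_square sum_product indicator_inter_arith algebra_simps)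
  have int: "integrable M (indicator (E p \<inter> E r) :: 'a \<Rightarrow> real)" if "p \<in> I" "r \<in> I" for p r
    using E that by (intro integrable_real_indicator) (auto simp: less_top[symmetric])
  have int1: "integrable M (indicator (E p) :: 'a \<Rightarrow> real)" if "p \<in> I" for p
    using int[OF that that] by simp
  have X: "integrable M X"
    unfolding X_def using int1 by (intro Bochner_Integration.integrable_sum integrable_mult_right) auto
  have X2: "integrable M (\<lambda>x. (X x)\<^sup>2)"
    unfolding sq using int by (intro Bochner_Integration.integrable_sum integrable_mult_right) auto
  have "expectation X = (\<Sum>p\<in>I. c p * prob (E p))"
    unfolding X_def using int1 E sets.Int_space_eq2[OF E]
    by (subst Bochner_Integration.integral_sum) (auto intro!: sum.cong)
  moreover have "expectation (\<lambda>x. (X x)\<^sup>2) = (\<Sum>p\<in>I. \<Sum>r\<in>I. c p * c r * prob (E p \<inter> E r))"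
  proof -
    have "expectation (\<lambda>x. (X x)\<^sup>2) = (\<Sum>p\<in>I. expectation (\<lambda>x. \<Sum>r\<in>I. c p * c r * indicator (E p \<inter> E r) x))"
      unfolding sq using int
      by (intro Bochner_Integration.integral_sum Bochner_Integration.integrable_sum integrable_mult_right) auto
    also have "\<dots> = (\<Sum>p\<in>I. \<Sum>r\<in>I. expectation (\<lambda>x. c p * c r * indicator (E p \<inter> E r) x))"
      using int by (intro sum.cong refl Bochner_Integration.integral_sum integrable_mult_right) auto
    also have "\<dots> = (\<Sum>p\<in>I. \<Sum>r\<in>I. c p * c r * prob (E p \<inter> E r))"
      using sets.Int_space_eq2[OF sets.Int[OF E E]] by (auto intro!: sum.cong)
    finally show ?thesis .
  qed
  ultimately show ?thesis
    using variance_eq[OF X X2] variance_positive[of X] by simp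
qed

text \<open>The group laws are restricted to \<open>space M\<close>, where the iterates are
  meaningful. Invariance is stated through \<open>distr\<close> so that it passes to product
  measures.\<close>

locale int_action = prob_space M for M :: "'a measure" +
  fixes V :: "int \<Rightarrow> 'a \<Rightarrow> 'a"
  assumes V_measurable [measurable]: "V n \<in> measurable M M"
    and V_distr: "distr M M (V n) = M"
    and V_add: "x \<in> space M \<Longrightarrow> V m (V n x) = V (m + n) x"
    and V_0: "x \<in> space M \<Longrightarrow> V 0 x = x"
begin

lemma V_space: "x \<in> space M \<Longrightarrow> V n x \<in> space M"
  using measurable_space[OF V_measurable] .

lemma prob_V:
  assumes [measurable]: "Measurable.pred M P"
  shows "prob {x \<in> space M. P (V n x)} = prob {x \<in> space M. P x}"
proof -
  have "prob {x \<in> space M. P x} = measure (distr M M (V n)) {x \<in> space M. P x}"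
    by (simp add: V_distr)
  also have "\<dots> = prob {x \<in> space M. P (V n x)}"
    by (subst measure_distr) (auto intro!: arg_cong[where f = prob] simp: V_space)
  finally show ?thesis by simp
qed

end

locale labelled_int_action = int_action M V for M :: "'a measure" and V +
  fixes lab :: "'a \<Rightarrow> nat" and K :: nat
  assumes lab_measurable [measurable]: "lab \<in> measurable M (count_space UNIV)"
    and lab_less: "x \<in> space M \<Longrightarrow> lab x < K"
begin

definition part :: "nat \<Rightarrow> real" where
  "part k = prob {x \<in> space M. lab x = k}"

definition corr :: "int \<Rightarrow> nat \<Rightarrow> nat \<Rightarrow> real" where
  "corr n k l = prob {x \<in> space M. lab x = k \<and> lab (V n x) = l}"

lemma corr_diff:
  "prob {x \<in> space M. lab (V i x) = k \<and> lab (V j x) = l} = corr (j - i) k l"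
proof -
  have "corr (j - i) k l = prob {x \<in> space M. lab (V i x) = k \<and> lab (V (j - i) (V i x)) = l}"
    unfolding corr_def by (rule prob_V[symmetric, where P = "\<lambda>x. lab x = k \<and> lab (V (j - i) x) = l"]) measurable
  also have "\<dots> = prob {x \<in> space M. lab (V i x) = k \<and> lab (V j x) = l}"
    by (intro arg_cong[where f = prob]) (auto simp: V_add)
  finally show ?thesis by simp
qed

sublocale correlation K part corr
proof
  show "corr (- n) k l = corr n l k" for n k l
  proof -
    have "corr (- n) k l = corr (0 - n) k l" by simp
    also have "\<dots> = prob {x \<in> space M. lab (V n x) = k \<and> lab (V 0 x) = l}"
      by (rule corr_diff[symmetric])
    also have "\<dots> = corr n l k"
      unfolding corr_def by (intro arg_cong[where f = prob]) (auto simp: V_0)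
    finally show ?thesis .
  qed
  show "0 \<le> corr n k l" for n k l by (simp add: corr_def)
  show "corr n k l \<le> 1" for n k l by (simp add: corr_def)
  show "(\<Sum>l<K. corr n k l) = part k" for n k
    unfolding corr_def part_def
    by (subst finite_measure_finite_Union[symmetric])
       (auto simp: disjoint_family_on_def lab_less V_space intro!: arg_cong[where f = prob])
  have "(\<Sum>k<K. part k) = prob (space M)"
    unfolding part_def
    by (subst finite_measure_finite_Union[symmetric])
       (auto simp: disjoint_family_on_def lab_less V_space intro!: arg_cong[where f = prob])
  then show "(\<Sum>k<K. part k) = 1" by (simp add: prob_space)
  fix I :: "(nat \<times> nat) set" and c :: "nat \<times> nat \<Rightarrow> real" and lb :: "nat \<times> nat \<Rightarrow> nat"
    and t :: "nat \<times> nat \<Rightarrow> int"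
  assume I: "finite I"
  \<comment> \<open>\<open>gram\<close> is the variance inequality for the events that the label at
    time \<open>t p\<close> is \<open>lb p\<close>. By invariance the measure of an intersection
    depends only on the difference of the times.\<close>
  define E where "E p = {x \<in> space M. lab (V (t p) x) = lb p}" for p
  have E: "E p \<in> events" for p unfolding E_def by measurable
  have part: "prob (E p) = part (lb p)" for p
    unfolding E_def part_def by (rule prob_V) measurable
  have "prob (E p \<inter> E r) = corr (t r - t p) (lb p) (lb r)" for p r
    unfolding corr_diff[symmetric] E_def by (intro arg_cong[where f = prob]) auto
  with weighted_prob_sum_square_le[OF I E, of c]
  show "(\<Sum>p\<in>I. c p * part (lb p))\<^sup>2 \<le>
      (\<Sum>p\<in>I. \<Sum>r\<in>I. c p * c r * corr (t r - t p) (lb p) (lb r))"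
    by (simp add: part)
qed

end

section \<open>Approximation by finite grids\<close>

text \<open>Finite unions of rectangles; the sides of the grid are the level sets of \<open>f\<close> and \<open>h\<close>.\<close>

definition grid_set :: "'a measure \<Rightarrow> 'b measure \<Rightarrow> ('a \<times> 'b) set \<Rightarrow> bool" where
  "grid_set M N B \<longleftrightarrow> (\<exists>f h K L g.
     f \<in> measurable M (count_space UNIV) \<and> (\<forall>x\<in>space M. f x < (K::nat)) \<and>
     h \<in> measurable N (count_space UNIV) \<and> (\<forall>y\<in>space N. h y < (L::nat)) \<and>
     B = {z \<in> space (M \<Otimes>\<^sub>M N). g (f (fst z)) (h (snd z))})"

lemma grid_set_sets:
  assumes "grid_set M N B" shows "B \<in> sets (M \<Otimes>\<^sub>M N)"
proof -
  from assms obtain f h and g :: "nat \<Rightarrow> nat \<Rightarrow> bool" where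
    [measurable]: "f \<in> measurable M (count_space UNIV)" "h \<in> measurable N (count_space UNIV)"
    and B: "B = {z \<in> space (M \<Otimes>\<^sub>M N). g (f (fst z)) (h (snd z))}"
    unfolding grid_set_def by blast
  show ?thesis unfolding B by measurable
qed

lemma grid_set_compl: "grid_set M N B \<Longrightarrow> grid_set M N (space (M \<Otimes>\<^sub>M N) - B)"
  unfolding grid_set_def
  apply (elim exE conjE)
  subgoal for f h K L g
    by (rule exI[of _ f], rule exI[of _ h], rule exI[of _ K], rule exI[of _ L],
        rule exI[of _ "\<lambda>k l. \<not> g k l"]) auto
  done

text \<open>Take the common refinement of the two grids: a pair of labels is coded as
  \<open>K' * k + k'\<close> and recovered by \<open>div\<close> and \<open>mod\<close>, which
  requires \<open>k' < K'\<close>.\<close>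

lemma grid_set_Un:
  assumes "grid_set M N B" "grid_set M N C"
  shows "grid_set M N (B \<union> C)"
proof -
  obtain f h and K L :: nat and g where [measurable]: "f \<in> measurable M (count_space UNIV)"
      "h \<in> measurable N (count_space UNIV)"
    and less: "\<forall>x\<in>space M. f x < K" "\<forall>y\<in>space N. h y < L"
    and B: "B = {z \<in> space (M \<Otimes>\<^sub>M N). g (f (fst z)) (h (snd z))}"
    using assms(1) unfolding grid_set_def by blast
  obtain f' h' and K' L' :: nat and g' where [measurable]: "f' \<in> measurable M (count_space UNIV)"
      "h' \<in> measurable N (count_space UNIV)"
    and less': "\<forall>x\<in>space M. f' x < K'" "\<forall>y\<in>space N. h' y < L'"
    and C: "C = {z \<in> space (M \<Otimes>\<^sub>M N). g' (f' (fst z)) (h' (snd z))}"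
    using assms(2) unfolding grid_set_def by blast
  have pair: "K' * k + k' < K' * K" if "k < K" "k' < K'" for k k' K K' :: nat
  proof -
    have "K' * k + k' < K' * Suc k" using that by simp
    also have "\<dots> \<le> K' * K" using that by (intro mult_left_mono) auto
    finally show ?thesis .
  qed
  have digits: "(K * k + k') div K = k" "(K * k + k') mod K = k'" if "k' < K" for k k' K :: nat
    using that by auto
  let ?f = "\<lambda>x. K' * f x + f' x" and ?h = "\<lambda>y. L' * h y + h' y"
  let ?g = "\<lambda>k l. g (k div K') (l div L') \<or> g' (k mod K') (l mod L')"
  have eq: "B \<union> C = {z \<in> space (M \<Otimes>\<^sub>M N). ?g (?f (fst z)) (?h (snd z))}"
    using less' by (auto simp: B C space_pair_measure digits)
  show ?thesis
    unfolding grid_set_def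
    by (rule exI[of _ ?f], rule exI[of _ ?h], rule exI[of _ "K' * K"], rule exI[of _ "L' * L"],
        rule exI[of _ ?g]) (use less less' pair eq in auto)
qed

lemma grid_set_Times:
  assumes [measurable]: "a \<in> sets M" "b \<in> sets N"
  shows "grid_set M N (a \<times> b)"
  unfolding grid_set_def
  by (rule exI[of _ "\<lambda>x. if x \<in> a then 1 else 0"], rule exI[of _ "\<lambda>y. if y \<in> b then 1 else 0"],
      rule exI[of _ 2], rule exI[of _ 2], rule exI[of _ "\<lambda>k l. k = 1 \<and> l = 1"])
     (use sets.sets_into_space[OF assms(1)] sets.sets_into_space[OF assms(2)] in
       \<open>auto simp: space_pair_measure\<close>)

text \<open>The sets that grid sets approximate to every precision include the rectangles and are
  closed under complements and countable unions, so induction over the generated sigma-algebra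
  applies.\<close>

lemma approx_by_grid_set:
  assumes "prob_space M" "prob_space N" and A: "A \<in> sets (M \<Otimes>\<^sub>M N)" and e: "e > 0"
  shows "\<exists>B. grid_set M N B \<and> measure (M \<Otimes>\<^sub>M N) (sym_diff A B) < e"
proof -
  interpret M: prob_space M by fact
  interpret N: prob_space N by fact
  interpret P: pair_prob_space M N ..
  let ?P = "M \<Otimes>\<^sub>M N"
  have sets_eq: "sets ?P = sigma_sets (space ?P) {a \<times> b |a b. a \<in> sets M \<and> b \<in> sets N}"
    by (simp add: sets_pair_measure space_pair_measure)
  have "A \<in> sigma_sets (space ?P) {a \<times> b |a b. a \<in> sets M \<and> b \<in> sets N}"
    using A sets_eq by simp
  then have "\<forall>e>0. \<exists>B. grid_set M N B \<and> measure ?P (sym_diff A B) < e"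
  proof induction
    case (Basic C)
    then obtain a b where "C = a \<times> b" "a \<in> sets M" "b \<in> sets N" by blast
    then show ?case using grid_set_Times[of a M b N] by (intro allI impI exI[of _ C]) simp
  next
    case Empty
    show ?case using grid_set_Times[of "{}" M "{}" N] by (intro allI impI exI[of _ "{}"]) simp
  next
    case (Compl C)
    show ?case
    proof (intro allI impI)
      fix e :: real assume "e > 0"
      then obtain B where B: "grid_set M N B" "measure ?P (sym_diff C B) < e"
        using Compl by blast
      have "C \<subseteq> space ?P" "B \<subseteq> space ?P"
        using Compl(1) sets.sets_into_space[of C ?P] grid_set_sets[OF B(1), THEN sets.sets_into_space] sets_eq
        by auto
      then have "sym_diff (space ?P - C) (space ?P - B) = sym_diff C B" by auto
      then show "\<exists>B. grid_set M N B \<and> measure ?P (sym_diff (space ?P - C) B) < e"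
        using grid_set_compl[OF B(1)] B(2) by metis
    qed
  next
    case (Union C)
    have C: "C i \<in> sets ?P" for i using Union(1) sets_eq by simp
    have finite: "\<exists>B. grid_set M N B \<and> measure ?P (sym_diff (\<Union>i<n. C i) B) < e" if "e > 0" for n e
      using that
    proof (induction n arbitrary: e)
      case 0
      then show ?case using grid_set_Times[of "{}" M "{}" N] by (intro exI[of _ "{}"]) simp
    next
      case (Suc n)
      then have "e / 2 > 0" by simp
      obtain B where B: "grid_set M N B" "measure ?P (sym_diff (\<Union>i<n. C i) B) < e / 2"
        using Suc.IH[OF \<open>e / 2 > 0\<close>] by blast
      obtain B' where B': "grid_set M N B'" "measure ?P (sym_diff (C n) B') < e / 2"
        using Union(2)[of n] \<open>e / 2 > 0\<close> by blast
      note [measurable] = C grid_set_sets[OF B(1)] grid_set_sets[OF B'(1)]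
      have "measure ?P (sym_diff (\<Union>i<Suc n. C i) (B \<union> B')) \<le>
          measure ?P (sym_diff (\<Union>i<n. C i) B \<union> sym_diff (C n) B')"
        by (intro P.finite_measure_mono) (auto simp: lessThan_Suc)
      also have "\<dots> \<le> measure ?P (sym_diff (\<Union>i<n. C i) B) + measure ?P (sym_diff (C n) B')"
        by (intro measure_Un_le) measurable
      also have "\<dots> < e" using B B' by simp
      finally show ?case using grid_set_Un[OF B(1) B'(1)] by blast
    qed
    show ?case
    proof (intro allI impI)
      fix e :: real assume e: "e > 0"
      \<comment> \<open>Continuity from below replaces the countable union by a finite one at the
        cost e / 2.\<close>
      have "(\<lambda>n. measure ?P (\<Union>i<n. C i)) \<longlonglongrightarrow> measure ?P (\<Union>n. \<Union>i<n. C i)"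
      proof (rule P.finite_Lim_measure_incseq)
        show "range (\<lambda>n. \<Union>i<n. C i) \<subseteq> sets ?P" using C by auto
        show "incseq (\<lambda>n. \<Union>i<n. C i)" by (intro monoI UN_mono) auto
      qed
      moreover have "(\<Union>n. \<Union>i<n. C i) = (\<Union>i. C i)" by auto
      ultimately have "\<forall>\<^sub>F n in sequentially. measure ?P (\<Union>i. C i) - e / 2 < measure ?P (\<Union>i<n. C i)"
        using e by (intro order_tendstoD(1)[of _ "measure ?P (\<Union>i. C i)"]) auto
      then obtain n where n: "measure ?P (\<Union>i. C i) - e / 2 < measure ?P (\<Union>i<n. C i)"
        by (auto simp: eventually_sequentially)
      obtain B where B: "grid_set M N B" "measure ?P (sym_diff (\<Union>i<n. C i) B) < e / 2"
        using finite[of "e / 2" n] e by auto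
      note [measurable] = C grid_set_sets[OF B(1)]
      have rest: "measure ?P ((\<Union>i. C i) - (\<Union>i<n. C i)) < e / 2"
        using n by (subst P.finite_measure_Diff) auto
      have "measure ?P (sym_diff (\<Union>i. C i) B) \<le>
          measure ?P (((\<Union>i. C i) - (\<Union>i<n. C i)) \<union> sym_diff (\<Union>i<n. C i) B)"
        by (intro P.finite_measure_mono) (measurable, auto)
      also have "\<dots> \<le> measure ?P ((\<Union>i. C i) - (\<Union>i<n. C i)) + measure ?P (sym_diff (\<Union>i<n. C i) B)"
        by (intro measure_Un_le) measurable
      also have "\<dots> < e" using B rest by simp
      finally show "\<exists>B. grid_set M N B \<and> measure ?P (sym_diff (\<Union>i. C i) B) < e"
        using B(1) by blast
    qed
  qed
  then show ?thesis using e by blast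
qed

section \<open>Products of two systems\<close>

lemma int_iterate_in:
  assumes S: "bij_betw S B B" and x: "x \<in> B"
  shows "int_iterate B S n x \<in> B"
proof -
  have "(S ^^ k) x \<in> B" for k
    by (induction k) (use x bij_betwE[OF S] in auto)
  moreover have "(inv_into B S ^^ k) x \<in> B" for k
    by (induction k) (use x bij_betwE[OF bij_betw_inv_into[OF S]] in auto)
  ultimately show ?thesis by (simp add: int_iterate_def)
qed

lemma int_iterate_plus_one:
  assumes S: "bij_betw S B B" and x: "x \<in> B"
  shows "int_iterate B S (n + 1) x = S (int_iterate B S n x)"
proof (cases "n \<ge> 0")
  case True
  then have "nat (n + 1) = Suc (nat n)" by simp
  with True show ?thesis by (simp add: int_iterate_def)
next
  case False
  \<comment> \<open>With n = -(k + 1), the iterate at n + 1 has k inverses, and \<open>S\<close>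
    undoes the outermost of the k + 1 inverses at n.\<close>
  define k where "k = nat (- n) - 1"
  have n: "n = - int (Suc k)" using False by (simp add: k_def)
  have "int_iterate B S (- int j) x = (inv_into B S ^^ j) x" for j
    by (cases j) (auto simp: int_iterate_def nat_add_distrib simp del: funpow.simps)
  note neg = this[of k] this[of "Suc k"]
  have "(inv_into B S ^^ k) x \<in> S ` B"
    using int_iterate_in[OF S x, of "- int k"] S by (simp add: neg bij_betw_def)
  then show ?thesis
    using neg by (simp add: n f_inv_into_f)
qed

text \<open>Induction on m in both directions from 0. In the downward step the two sides agree after
  one application of \<open>S\<close>, which is injective on \<open>B\<close>.\<close>

lemma int_iterate_add:
  assumes S: "bij_betw S B B" and x: "x \<in> B"
  shows "int_iterate B S m (int_iterate B S n x) = int_iterate B S (m + n) x"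
proof (induction m rule: int_induct[where k = 0])
  case base
  show ?case by (simp add: int_iterate_def)
next
  case (step1 i)
  then show ?case
    using int_iterate_plus_one[OF S x, of "i + n"] int_iterate_plus_one[OF S int_iterate_in[OF S x], of i n]
    by (simp add: algebra_simps)
next
  case (step2 i)
  have "S (int_iterate B S (i - 1) (int_iterate B S n x)) = S (int_iterate B S (i - 1 + n) x)"
    using step2(2) int_iterate_plus_one[OF S x, of "i - 1 + n"]
      int_iterate_plus_one[OF S int_iterate_in[OF S x], of "i - 1" n]
    by (simp add: algebra_simps)
  then show ?case
    using S int_iterate_in[OF S x] int_iterate_in[OF S int_iterate_in[OF S x]]
    by (meson bij_betw_imp_inj_on inj_onD)
qed

lemma int_iterate_image:
  assumes S: "bij_betw S B B" and A: "A \<subseteq> B"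
  shows "int_iterate B S n ` A = {x \<in> B. int_iterate B S (- n) x \<in> A}"
proof (intro equalityI subsetI)
  fix y assume "y \<in> int_iterate B S n ` A"
  then show "y \<in> {x \<in> B. int_iterate B S (- n) x \<in> A}"
    using A int_iterate_in[OF S] int_iterate_add[OF S, of _ "- n" n] by (auto simp: int_iterate_def[of _ _ 0])
next
  fix y assume y: "y \<in> {x \<in> B. int_iterate B S (- n) x \<in> A}"
  then have "y = int_iterate B S n (int_iterate B S (- n) y)"
    using int_iterate_add[OF S, of y n "- n"] by (simp add: int_iterate_def[of _ _ 0])
  with y show "y \<in> int_iterate B S n ` A" by blast
qed

lemma int_iterate_map_prod:
  assumes S: "bij_betw S B B" and R: "bij_betw R C C" and x: "x \<in> B" and y: "y \<in> C"
  shows "int_iterate (B \<times> C) (map_prod S R) n (x, y) = (int_iterate B S n x, int_iterate C R n y)"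
proof -
  have prod: "bij_betw (map_prod S R) (B \<times> C) (B \<times> C)"
    using bij_betw_map_prod[OF S R] by (simp add: map_prod_def)
  have inv: "inv_into (B \<times> C) (map_prod S R) (u, v) = (inv_into B S u, inv_into C R v)"
    if "u \<in> B" "v \<in> C" for u v
  proof (rule inv_into_f_eq)
    show "inj_on (map_prod S R) (B \<times> C)" using prod by (simp add: bij_betw_def)
    show "(inv_into B S u, inv_into C R v) \<in> B \<times> C"
      using that bij_betwE[OF bij_betw_inv_into[OF S]] bij_betwE[OF bij_betw_inv_into[OF R]] by auto
    show "map_prod S R (inv_into B S u, inv_into C R v) = (u, v)"
      using that bij_betw_inv_into_right[OF S] bij_betw_inv_into_right[OF R] by simp
  qed
  have "(map_prod S R ^^ k) (x, y) = ((S ^^ k) x, (R ^^ k) y)" for k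
    by (induction k) auto
  moreover have "(inv_into (B \<times> C) (map_prod S R) ^^ k) (x, y) = ((inv_into B S ^^ k) x, (inv_into C R ^^ k) y) \<and>
      (inv_into B S ^^ k) x \<in> B \<and> (inv_into C R ^^ k) y \<in> C" for k
    by (induction k)
       (use x y inv bij_betwE[OF bij_betw_inv_into[OF S]] bij_betwE[OF bij_betw_inv_into[OF R]] in auto)
  ultimately show ?thesis by (simp add: int_iterate_def)
qed

lemma int_iterate_id: "x \<in> B \<Longrightarrow> int_iterate B id n x = x"
proof -
  assume x: "x \<in> B"
  have "(inv_into B id ^^ k) x = x" for k
    by (induction k) (use x in \<open>auto intro: inv_into_f_eq\<close>)
  then show ?thesis by (simp add: int_iterate_def)
qed

text \<open>The sign of the exponent is chosen so that the action at time n sends a point x of the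
  space into A exactly when x lies in S^n A.\<close>

lemma int_action_if_invertible_mps:
  assumes "invertible_mps M S"
  shows "int_action M (\<lambda>n. int_iterate (space M) S (- n))"
proof -
  have S: "bij_betw S (space M) (space M)" and [measurable]: "S \<in> measurable M M"
    and [measurable]: "inv_into (space M) S \<in> measurable M M" and "prob_space M"
    and pres: "\<And>B. B \<in> sets M \<Longrightarrow> measure M (S -` B \<inter> space M) = measure M B"
    using assms by (auto simp: invertible_mps_def measure_preserving_system_def)
  interpret prob_space M by fact
  have dS: "distr M M S = M"
    by (rule measure_eqI) (auto simp: emeasure_distr emeasure_eq_measure pres)
  \<comment> \<open>Invariance under the inverse: pushing \<open>M\<close> forward by
    \<open>S\<close> and then by the inverse gives \<open>M\<close> back, and the first push already
    gives \<open>M\<close>.\<close>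
  have "M = distr M M (\<lambda>x. x)" by (simp add: distr_id2)
  also have "\<dots> = distr M M (inv_into (space M) S \<circ> S)"
    using S by (intro distr_cong) (auto simp: bij_betw_inv_into_left)
  also have "\<dots> = distr (distr M M S) M (inv_into (space M) S)"
    by (rule distr_distr[symmetric]) measurable
  finally have dI: "distr M M (inv_into (space M) S) = M" by (simp add: dS)
  have pow: "R ^^ k \<in> measurable M M \<and> distr M M (R ^^ k) = M"
    if [measurable]: "R \<in> measurable M M" and R: "distr M M R = M" for R :: "'a \<Rightarrow> 'a" and k
  proof (induction k)
    case 0
    then show ?case by (simp add: id_def distr_id2)
  next
    case (Suc k)
    then have [measurable]: "R ^^ k \<in> measurable M M" by simp
    have "distr M M (R \<circ> R ^^ k) = distr (distr M M (R ^^ k)) M R"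
      by (rule distr_distr[symmetric]) measurable
    also have "\<dots> = M" using Suc R by simp
    finally have "distr M M (R \<circ> R ^^ k) = M" .
    moreover have "R \<circ> R ^^ k \<in> measurable M M"
      by (rule measurable_comp) measurable
    ultimately show ?case by (simp only: funpow.simps)
  qed
  show ?thesis
  proof
    fix n
    show "int_iterate (space M) S (- n) \<in> measurable M M"
      using pow[of S] pow[of "inv_into (space M) S"] dS dI by (simp add: int_iterate_def)
    show "distr M M (int_iterate (space M) S (- n)) = M"
      using pow[of S] pow[of "inv_into (space M) S"] dS dI by (simp add: int_iterate_def)
  next
    fix x m n assume x: "x \<in> space M"
    show "int_iterate (space M) S (- m) (int_iterate (space M) S (- n) x) = int_iterate (space M) S (- (m + n)) x"
      by (simp add: int_iterate_add[OF S x])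
    show "int_iterate (space M) S (- 0) x = x" by (simp add: int_iterate_def)
  qed
qed

section \<open>Triple intersections in a product of two actions\<close>

locale int_action_pair = A1: int_action M V + A2: int_action N W
  for M :: "'a measure" and V and N :: "'b measure" and W
begin

sublocale P: pair_prob_space M N ..

text \<open>For the actions by S_1^(-n) and S_2^(-n) this is A cap T_1^n A cap T_2^n A, expressed by
  points instead of images.\<close>

definition triple :: "int \<Rightarrow> ('a \<times> 'b) set \<Rightarrow> ('a \<times> 'b) set" where
  "triple n A = {z \<in> space (M \<Otimes>\<^sub>M N). z \<in> A \<and> (V n (fst z), snd z) \<in> A \<and> (fst z, W n (snd z)) \<in> A}"

lemma triple_sets [measurable]:
  assumes [measurable]: "A \<in> sets (M \<Otimes>\<^sub>M N)"
  shows "triple n A \<in> sets (M \<Otimes>\<^sub>M N)"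
  unfolding triple_def by measurable

lemma prob_V_fst:
  assumes D: "D \<in> sets (M \<Otimes>\<^sub>M N)"
  shows "P.prob {z \<in> space (M \<Otimes>\<^sub>M N). (V n (fst z), snd z) \<in> D} = P.prob D"
proof -
  have "M \<Otimes>\<^sub>M N = distr M M (V n) \<Otimes>\<^sub>M distr N N (\<lambda>y. y)"
    by (simp add: A1.V_distr distr_id2)
  also have "\<dots> = distr (M \<Otimes>\<^sub>M N) (M \<Otimes>\<^sub>M N) (\<lambda>(x, y). (V n x, y))"
    by (rule pair_measure_distr) (auto simp: distr_id2 A2.sigma_finite_measure_axioms)
  finally have "P.prob D = measure (distr (M \<Otimes>\<^sub>M N) (M \<Otimes>\<^sub>M N) (\<lambda>(x, y). (V n x, y))) D"
    by simp
  also have "\<dots> = P.prob {z \<in> space (M \<Otimes>\<^sub>M N). (V n (fst z), snd z) \<in> D}"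
    using D by (subst measure_distr) (auto intro!: arg_cong[where f = P.prob])
  finally show ?thesis by simp
qed

lemma prob_W_snd:
  assumes D: "D \<in> sets (M \<Otimes>\<^sub>M N)"
  shows "P.prob {z \<in> space (M \<Otimes>\<^sub>M N). (fst z, W n (snd z)) \<in> D} = P.prob D"
proof -
  have "M \<Otimes>\<^sub>M N = distr M M (\<lambda>x. x) \<Otimes>\<^sub>M distr N N (W n)"
    by (simp add: A2.V_distr distr_id2)
  also have "\<dots> = distr (M \<Otimes>\<^sub>M N) (M \<Otimes>\<^sub>M N) (\<lambda>(x, y). (x, W n y))"
    by (rule pair_measure_distr) (auto simp: A2.V_distr A2.sigma_finite_measure_axioms)
  finally have "P.prob D = measure (distr (M \<Otimes>\<^sub>M N) (M \<Otimes>\<^sub>M N) (\<lambda>(x, y). (x, W n y))) D"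
    by simp
  also have "\<dots> = P.prob {z \<in> space (M \<Otimes>\<^sub>M N). (fst z, W n (snd z)) \<in> D}"
    using D by (subst measure_distr) (auto intro!: arg_cong[where f = P.prob])
  finally show ?thesis by simp
qed

text \<open>A point of \<open>triple n B\<close> outside \<open>triple n A\<close> lies in the
  symmetric difference or is moved there by one of the two maps. By invariance these three
  exceptional sets have equal measure.\<close>

lemma prob_triple_le:
  assumes [measurable]: "A \<in> sets (M \<Otimes>\<^sub>M N)" "B \<in> sets (M \<Otimes>\<^sub>M N)"
  shows "P.prob (triple n B) \<le> P.prob (triple n A) + 3 * P.prob (sym_diff A B)"
proof -
  let ?D = "sym_diff A B"
  let ?D1 = "{z \<in> space (M \<Otimes>\<^sub>M N). (V n (fst z), snd z) \<in> ?D}"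
  let ?D2 = "{z \<in> space (M \<Otimes>\<^sub>M N). (fst z, W n (snd z)) \<in> ?D}"
  have D [measurable]: "?D \<in> sets (M \<Otimes>\<^sub>M N)" by measurable
  have [measurable]: "?D1 \<in> sets (M \<Otimes>\<^sub>M N)" "?D2 \<in> sets (M \<Otimes>\<^sub>M N)" by measurable
  have "P.prob (triple n B) \<le> P.prob (triple n A \<union> (?D \<union> (?D1 \<union> ?D2)))"
    by (intro P.finite_measure_mono) (measurable, auto simp: triple_def)
  also have "\<dots> \<le> P.prob (triple n A) + P.prob (?D \<union> (?D1 \<union> ?D2))"
    by (intro measure_Un_le) measurable
  also have "P.prob (?D \<union> (?D1 \<union> ?D2)) \<le> P.prob ?D + P.prob (?D1 \<union> ?D2)"
    by (intro measure_Un_le) measurable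
  also have "P.prob (?D1 \<union> ?D2) \<le> P.prob ?D1 + P.prob ?D2"
    by (intro measure_Un_le) measurable
  finally show ?thesis unfolding prob_V_fst[OF D] prob_W_snd[OF D] by simp
qed

end

text \<open>The set is a disjoint union of rectangles. Label types are arbitrary because both labels
  and pairs of labels will be inserted.\<close>

lemma (in pair_prob_space) prob_labels:
  fixes F :: "'a \<Rightarrow> 'i" and H :: "'b \<Rightarrow> 'j"
  assumes fin: "finite I" "finite J"
    and F: "\<And>x. x \<in> space M1 \<Longrightarrow> F x \<in> I" "\<And>i. {x \<in> space M1. F x = i} \<in> sets M1"
    and H: "\<And>y. y \<in> space M2 \<Longrightarrow> H y \<in> J" "\<And>j. {y \<in> space M2. H y = j} \<in> sets M2"
  shows "prob {z \<in> space (M1 \<Otimes>\<^sub>M M2). Q (F (fst z)) (H (snd z))} =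
    (\<Sum>i\<in>I. \<Sum>j\<in>J. of_bool (Q i j) * (M1.prob {x \<in> space M1. F x = i} * M2.prob {y \<in> space M2. H y = j}))"
proof -
  define X where "X = (\<lambda>(i, j). if Q i j then {x \<in> space M1. F x = i} \<times> {y \<in> space M2. H y = j} else {})"
  have X: "X p \<in> sets (M1 \<Otimes>\<^sub>M M2)" for p using F(2) H(2) by (auto simp: X_def split: prod.split)
  have "{z \<in> space (M1 \<Otimes>\<^sub>M M2). Q (F (fst z)) (H (snd z))} = (\<Union>p\<in>I \<times> J. X p)"
  proof (intro equalityI subsetI)
    fix z assume z: "z \<in> {z \<in> space (M1 \<Otimes>\<^sub>M M2). Q (F (fst z)) (H (snd z))}"
    then have "z \<in> X (F (fst z), H (snd z))" "(F (fst z), H (snd z)) \<in> I \<times> J"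
      using F(1) H(1) by (auto simp: X_def space_pair_measure)
    then show "z \<in> (\<Union>p\<in>I \<times> J. X p)" by blast
  qed (auto simp: X_def space_pair_measure split: if_splits)
  also have "prob \<dots> = (\<Sum>p\<in>I \<times> J. prob (X p))"
    using fin X by (intro finite_measure_finite_Union)
      (auto simp: disjoint_family_on_def X_def split: if_splits)
  also have "\<dots> = (\<Sum>i\<in>I. \<Sum>j\<in>J. prob (X (i, j)))"
    by (simp add: sum.cartesian_product')
  also have "\<dots> = (\<Sum>i\<in>I. \<Sum>j\<in>J. of_bool (Q i j) *
      (M1.prob {x \<in> space M1. F x = i} * M2.prob {y \<in> space M2. H y = j}))"
  proof (intro sum.cong refl)
    fix i j
    show "prob (X (i, j)) = of_bool (Q i j) *
      (M1.prob {x \<in> space M1. F x = i} * M2.prob {y \<in> space M2. H y = j})"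
      using F(2)[of i] H(2)[of j]
      by (simp add: X_def measure_def M2.emeasure_pair_measure_Times enn2real_mult)
  qed
  finally show ?thesis .
qed

section \<open>The lower bound for finite grids\<close>

locale labelled_int_action_pair =
  L1: labelled_int_action M V f K + L2: labelled_int_action N W h L
  for M :: "'a measure" and V f K and N :: "'b measure" and W h L +
  fixes g :: "nat \<Rightarrow> nat \<Rightarrow> bool"
begin

sublocale int_action_pair M V N W ..

definition grid :: "('a \<times> 'b) set" where
  "grid = {z \<in> space (M \<Otimes>\<^sub>M N). g (f (fst z)) (h (snd z))}"

abbreviation G :: "nat \<Rightarrow> nat \<Rightarrow> real" where
  "G k l \<equiv> of_bool (g k l)"

lemma prob_grid: "P.prob grid = (\<Sum>k<K. \<Sum>l<L. L1.part k * L2.part l * G k l)"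
  unfolding grid_def
  by (subst P.prob_labels[where I = "{..<K}" and J = "{..<L}"])
     (auto simp: L1.lab_less L2.lab_less L1.part_def L2.part_def intro!: sum.cong)

text \<open>Each coordinate is classified by its labels before and after the motion. Only one
  coordinate moves at a time, so for fixed k and l the sums over k' and l' separate.\<close>

lemma prob_triple_grid:
  "P.prob (triple n grid) =
    (\<Sum>k<K. \<Sum>l<L. G k l * (\<Sum>k'<K. L1.corr n k k' * G k' l) * (\<Sum>l'<L. L2.corr n l l' * G k l'))"
proof -
  have eq: "triple n grid = {z \<in> space (M \<Otimes>\<^sub>M N). (\<lambda>(k, k') (l, l'). g k l \<and> g k' l \<and> g k l')
      ((\<lambda>x. (f x, f (V n x))) (fst z)) ((\<lambda>y. (h y, h (W n y))) (snd z))}"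
    by (auto simp: triple_def grid_def space_pair_measure L1.V_space L2.V_space)
  have "P.prob (triple n grid) = (\<Sum>p\<in>{..<K} \<times> {..<K}. \<Sum>r\<in>{..<L} \<times> {..<L}.
      of_bool ((\<lambda>(k, k') (l, l'). g k l \<and> g k' l \<and> g k l') p r) *
      (L1.prob {x \<in> space M. (f x, f (V n x)) = p} * L2.prob {y \<in> space N. (h y, h (W n y)) = r}))"
    unfolding eq
    by (rule P.prob_labels)
       (auto simp: L1.lab_less L2.lab_less L1.V_space L2.V_space prod_eq_iff)
  also have "\<dots> = (\<Sum>k<K. \<Sum>k'<K. \<Sum>l<L. \<Sum>l'<L.
      of_bool (g k l \<and> g k' l \<and> g k l') * (L1.corr n k k' * L2.corr n l l'))"
    by (simp only: sum.cartesian_product' L1.corr_def L2.corr_def prod.case prod.inject)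
  also have "\<dots> = (\<Sum>k<K. \<Sum>k'<K. \<Sum>l<L. \<Sum>l'<L.
      G k l * (L1.corr n k k' * G k' l) * (L2.corr n l l' * G k l'))"
    by (intro sum.cong refl) (simp only: of_bool_conj mult_ac)
  also have "\<dots> = (\<Sum>k<K. \<Sum>l<L. \<Sum>k'<K. \<Sum>l'<L.
      G k l * (L1.corr n k k' * G k' l) * (L2.corr n l l' * G k l'))"
    by (intro sum.cong refl sum.swap)
  also have "\<dots> = (\<Sum>k<K. \<Sum>l<L. G k l * (\<Sum>k'<K. L1.corr n k k' * G k' l) * (\<Sum>l'<L. L2.corr n l l' * G k l'))"
    by (intro sum.cong refl) (simp only: mult.assoc sum_product, simp only: sum_distrib_left)
  finally show ?thesis .
qed

lemma exists_large_triple_grid: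
  assumes R: "\<not> syndetic R" and \<epsilon>: "\<epsilon> > 0"
  shows "\<exists>n. n \<notin> R \<and> P.prob grid ^ 3 - \<epsilon> \<le> P.prob (triple n grid)"
proof -
  \<comment> \<open>Error budget: 3 \<tau> is at most \<epsilon> / 2, and \<eta> keeps the error of
    \<open>sum_ratio_le\<close>, which enters twice, below or at \<epsilon> / 4 for both
    actions.\<close>
  define \<tau> where "\<tau> = min 1 (\<epsilon> / 6)"
  define D where "D = 1 + (real K / \<tau>)\<^sup>2 + (real L / \<tau>)\<^sup>2"
  define \<eta> where "\<eta> = \<epsilon> / 4 / D"
  have \<tau>: "0 < \<tau>" "\<tau> \<le> 1" "3 * \<tau> \<le> \<epsilon> / 2" using \<epsilon> by (auto simp: \<tau>_def)
  have D: "D > 0" unfolding D_def by (intro add_pos_nonneg) auto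
  have \<eta>: "\<eta> > 0" "D * \<eta> = \<epsilon> / 4" using \<epsilon> D by (simp_all add: \<eta>_def)
  have "(real K / \<tau>)\<^sup>2 * \<eta> \<ge> 0" "(real L / \<tau>)\<^sup>2 * \<eta> \<ge> 0" using \<eta>(1) by auto
  then have err: "\<eta> + (real K / \<tau>)\<^sup>2 * \<eta> \<le> \<epsilon> / 4" "\<eta> + (real L / \<tau>)\<^sup>2 * \<eta> \<le> \<epsilon> / 4"
    unfolding \<eta>(2)[symmetric] D_def distrib_right by linarith+
  obtain n where n: "n \<notin> R \<and> almost_symmetric_psd K L1.part (L1.corr n) (1 / \<tau>) \<eta> \<and>
      almost_symmetric_psd L L2.part (L2.corr n) (1 / \<tau>) \<eta>"
    using exists_almost_symmetric_psd_time[OF L1.correlation_axioms L2.correlation_axioms R \<eta>(1)] by (rule exE)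
  have "P.prob grid ^ 3 - 2 * (\<epsilon> / 4) - 3 * \<tau> \<le> P.prob (triple n grid)"
    unfolding prob_grid prob_triple_grid
  proof (rule triple_form_ge_cube)
    show "0 \<le> (\<Sum>k'<K. L1.corr n k k' * G k' l) \<and> (\<Sum>k'<K. L1.corr n k k' * G k' l) \<le> L1.part k"
      if "k < K" for k l
      unfolding L1.q_row[OF that, of n, symmetric]
      by (intro conjI sum_nonneg sum_mono mult_left_le mult_nonneg_nonneg L1.q_nonneg) auto
    show "0 \<le> (\<Sum>l'<L. L2.corr n l l' * G k l') \<and> (\<Sum>l'<L. L2.corr n l l' * G k l') \<le> L2.part l"
      if "l < L" for k l
      unfolding L2.q_row[OF that, of n, symmetric]
      by (intro conjI sum_nonneg sum_mono mult_left_le mult_nonneg_nonneg L2.q_nonneg) auto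
    show "(\<Sum>k<K. L1.part k * (G k l / ((\<Sum>k'<K. L1.corr n k k' * G k' l) / L1.part k + \<tau>))) \<le> 1 + \<epsilon> / 4" for l
      using sum_ratio_le[OF L1.q_nonneg L1.q_row _ \<tau>(1) less_imp_le[OF \<eta>(1)] conjunct1[OF conjunct2[OF n]], of "\<lambda>k. G k l"] err(1)
      by simp
    show "(\<Sum>l<L. L2.part l * (G k l / ((\<Sum>l'<L. L2.corr n l l' * G k l') / L2.part l + \<tau>))) \<le> 1 + \<epsilon> / 4" for k
      using sum_ratio_le[OF L2.q_nonneg L2.q_row _ \<tau>(1) less_imp_le[OF \<eta>(1)] conjunct2[OF conjunct2[OF n]], of "\<lambda>l. G k l"] err(2)
      by simp
  qed (use \<tau> \<epsilon> L1.a_nonneg L2.a_nonneg L1.a_sum L2.a_sum in auto)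
  with conjunct1[OF n] \<tau>(3) show ?thesis by (intro exI[of _ n]) linarith
qed

end

section \<open>From grids to arbitrary measurable sets\<close>

lemma cube_diff_le:
  fixes x y :: real
  assumes "0 \<le> x" "x \<le> 1" "0 \<le> y" "y \<le> 1" and "x \<le> y + d" and "d \<ge> 0"
  shows "x ^ 3 \<le> y ^ 3 + 3 * d"
proof -
  have "x ^ 3 - y ^ 3 = (x - y) * (x * x + x * y + y * y)"
    by (simp add: algebra_simps power3_eq_cube)
  also have "\<dots> \<le> d * (x * x + x * y + y * y)"
    using assms by (intro mult_right_mono) auto
  also have "\<dots> \<le> d * 3"
    using assms mult_le_one[of x x] mult_le_one[of x y] mult_le_one[of y y] by (intro mult_left_mono) auto
  finally show ?thesis by simp
qed

text \<open>The set handed to the grid estimate consists of the good times of \<open>A\<close>, not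
  of the grid. The time found there is thus bad for \<open>A\<close>, while the approximation shows
  it to be good.\<close>

theorem (in int_action_pair) syndetic_triple:
  assumes A: "A \<in> sets (M \<Otimes>\<^sub>M N)" and \<epsilon>: "\<epsilon> > 0"
  shows "syndetic {n. P.prob (triple n A) > P.prob A ^ 3 - \<epsilon>}" (is "syndetic ?R")
proof (rule ccontr)
  assume R: "\<not> syndetic ?R"
  \<comment> \<open>The cube and the triple measure each lose at most 3 \<epsilon> / 12; with the
    loss \<epsilon> / 4 on the grid the total stays strictly below \<epsilon>.\<close>
  obtain B where B: "grid_set M N B" "P.prob (sym_diff A B) < \<epsilon> / 12"
    using approx_by_grid_set[OF A1.prob_space_axioms A2.prob_space_axioms A, of "\<epsilon> / 12"] \<epsilon> by auto
  obtain f h and K L :: nat and g where "f \<in> measurable M (count_space UNIV)" "\<forall>x\<in>space M. f x < K"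
      "h \<in> measurable N (count_space UNIV)" "\<forall>y\<in>space N. h y < L"
    and B_eq: "B = {z \<in> space (M \<Otimes>\<^sub>M N). g (f (fst z)) (h (snd z))}"
    using B(1) unfolding grid_set_def by blast
  then interpret labelled_int_action_pair M V f K N W h L g
    by unfold_locales auto
  have B_grid: "B = grid" by (simp add: B_eq grid_def)
  obtain n where n: "n \<notin> ?R" "P.prob B ^ 3 - \<epsilon> / 4 \<le> P.prob (triple n B)"
    using exists_large_triple_grid[OF R, of "\<epsilon> / 4"] \<epsilon> by (auto simp: B_grid)
  note [measurable] = A grid_set_sets[OF B(1)]
  have "P.prob A \<le> P.prob (B \<union> sym_diff A B)"
    by (intro P.finite_measure_mono) auto
  also have "\<dots> \<le> P.prob B + P.prob (sym_diff A B)"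
    by (intro measure_Un_le) measurable
  finally have "P.prob A ^ 3 \<le> P.prob B ^ 3 + 3 * P.prob (sym_diff A B)"
    by (intro cube_diff_le) auto
  moreover have "P.prob (triple n B) \<le> P.prob (triple n A) + 3 * P.prob (sym_diff A B)"
    by (intro prob_triple_le A grid_set_sets B(1))
  ultimately have "P.prob (triple n A) > P.prob A ^ 3 - \<epsilon>" using n(2) B(2) \<epsilon> by linarith
  with n(1) show False by simp
qed

theorem theorem1p3:
  fixes Y1 :: "'a measure" and S1 :: "'a \<Rightarrow> 'a"
    and Y2 :: "'b measure" and S2 :: "'b \<Rightarrow> 'b"
    and X :: "('a \<times> 'b) measure" and T1 T2 :: "'a \<times> 'b \<Rightarrow> 'a \<times> 'b"
    and A :: "('a \<times> 'b) set" and \<epsilon> :: real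
  assumes "invertible_mps Y1 S1" and "ergodic_mps Y1 S1"
    and "invertible_mps Y2 S2" and "ergodic_mps Y2 S2"
    and "X = Y1 \<Otimes>\<^sub>M Y2"
    and "T1 = map_prod S1 id" and "T2 = map_prod id S2"
    and "A \<in> sets X" and "measure X A > 0"
    and "\<epsilon> > 0"
  shows "syndetic {n :: int. measure X (A \<inter> int_iterate (space X) T1 n ` A
                                          \<inter> int_iterate (space X) T2 n ` A)
                               > measure X A ^ 3 - \<epsilon>}"
proof -
  let ?V = "\<lambda>n. int_iterate (space Y1) S1 (- n)" and ?W = "\<lambda>n. int_iterate (space Y2) S2 (- n)"
  interpret A1: int_action Y1 ?V using assms(1) by (rule int_action_if_invertible_mps)
  interpret A2: int_action Y2 ?W using assms(3) by (rule int_action_if_invertible_mps)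
  interpret int_action_pair Y1 ?V Y2 ?W ..
  have S: "bij_betw S1 (space Y1) (space Y1)" "bij_betw S2 (space Y2) (space Y2)"
    using assms(1,3) by (auto simp: invertible_mps_def)
  have sp: "space X = space Y1 \<times> space Y2" using assms(5) by (simp add: space_pair_measure)
  have A: "A \<subseteq> space Y1 \<times> space Y2" using sets.sets_into_space[OF assms(8)] sp by simp
  have T: "bij_betw T1 (space X) (space X)" "bij_betw T2 (space X) (space X)"
    unfolding sp assms(6,7) using bij_betw_map_prod[OF S(1) bij_betw_id[of "space Y2"]]
      bij_betw_map_prod[OF bij_betw_id[of "space Y1"] S(2)] by (simp_all add: map_prod_def id_def)
  \<comment> \<open>Each image becomes a condition on the iterate with exponent -n, which moves one
    coordinate and fixes the other.\<close>
  have "A \<inter> int_iterate (space X) T1 n ` A \<inter> int_iterate (space X) T2 n ` A = triple n A" for n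
    unfolding int_iterate_image[OF T(1) A[folded sp]] int_iterate_image[OF T(2) A[folded sp]]
    using A unfolding triple_def assms(6,7) sp
    by (auto simp: space_pair_measure int_iterate_id
        int_iterate_map_prod[OF S(1) bij_betw_id] int_iterate_map_prod[OF bij_betw_id S(2)])
  then show ?thesis
    using syndetic_triple[of A \<epsilon>] assms(5,8,10) by simp
qed

end
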